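(* Let $\Lambda \subset H_{2n+1}$ be an infinite discrete approximate subgroup of the Heisenberg group $H_{2n+1}$, $n\ge 1$. Then there exists a connected non-trivial subgroup $H'$ in $H_{2n+1}$ such that $\Lambda$ is relatively dense around $H'$. Moreover, if $H'$ is non-abelian, then the projection of $\Lambda$ onto $V$ is discrete.
   Context: Let $n\ge 1$, let $V=\mathbb{R}^{2n}$ and let $\omega:V\times V\to\mathbb{R}$ be a symplectic form (bilinear, anti-symmetric and non-degenerate). The Heisenberg group is $H_{2n+1}=\{(v,z): v\in V, z\in\mathbb{R}\}$ with multiplication $(v_1,z_1)\cdot(v_2,z_2)=\left(v_1+v_2,\,z_1+z_2+\tfrac12\omega(v_1,v_2)\right)$. The projection onto $V$ is the map $(v,z)\mapsto v$. The group $H_{2n+1}$ is equipped with a left-invariant metric, in whose topology $(v_k,z_k)\to(v,z)$ if and only if $v_k\to v$ in $V$ and $z_k\to z$ in $\mathbb{R}$; $V$ carries the Euclidean metric. In a metric space, $B_r(h)$ denotes the closed ball of radius $r$ around $h$. A set $\Lambda\subset H_{2n+1}$ is an approximate subgroup if it contains the identity element, satisfies $\Lambda^{-1}=\Lambda$, and there exists a finite set $F\subset H_{2n+1}$ with $\Lambda^{-1}\Lambda\subset F\Lambda$. A subset $\Lambda$ of $H_{2n+1}$ or of $V$ is discrete if for every $\ell\in\Lambda$ there exists $\delta=\delta(\ell)>0$ such that $B_\delta(\ell)\cap\Lambda=\{\ell\}$. For a subgroup $H'$ of $H_{2n+1}$, a set $\Lambda\subset H_{2n+1}$ is relatively dense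 around $H'$ if there exists $R>0$ such that (i) $B_R(h)\cap\Lambda\neq\emptyset$ for every $h\in H'$, and (ii) $\Lambda\subset\bigcup_{h\in H'}B_R(h)$. *)

theory Defs
  imports "HOL-Analysis.Analysis" "HOL-Algebra.Coset"
begin

definition symplectic_form :: "('v::real_vector \<Rightarrow> 'v \<Rightarrow> real) \<Rightarrow> bool" where
  "symplectic_form \<omega> \<longleftrightarrow>
     bilinear \<omega> \<and>
     (\<forall>v w. \<omega> v w = - \<omega> w v) \<and>
     (\<forall>v. (\<forall>w. \<omega> v w = 0) \<longrightarrow> v = 0)"

definition heisenberg :: "('v::real_vector \<Rightarrow> 'v \<Rightarrow> real) \<Rightarrow> ('v \<times> real) monoid" where
  "heisenberg \<omega> =
     \<lparr>carrier = UNIV,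
      mult = (\<lambda>(v\<^sub>1, z\<^sub>1) (v\<^sub>2, z\<^sub>2). (v\<^sub>1 + v\<^sub>2, z\<^sub>1 + z\<^sub>2 + \<omega> v\<^sub>1 v\<^sub>2 / 2)),
      one = (0, 0)\<rparr>"

lemma carrier_heisenberg [simp]: "carrier (heisenberg \<omega>) = UNIV"
  by (simp add: heisenberg_def)

lemma one_heisenberg [simp]: "\<one>\<^bsub>heisenberg \<omega>\<^esub> = (0, 0)"
  by (simp add: heisenberg_def)

lemma mult_heisenberg [simp]:
  "(v\<^sub>1, z\<^sub>1) \<otimes>\<^bsub>heisenberg \<omega>\<^esub> (v\<^sub>2, z\<^sub>2) = (v\<^sub>1 + v\<^sub>2, z\<^sub>1 + z\<^sub>2 + \<omega> v\<^sub>1 v\<^sub>2 / 2)"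
  by (simp add: heisenberg_def)

lemma group_heisenberg:
  assumes "symplectic_form \<omega>"
  shows "group (heisenberg \<omega>)"
proof -
  have lin: "linear (\<lambda>v. \<omega> v w)" "linear (\<omega> w)" and anti: "\<omega> v w = - \<omega> w v" for v w
    using assms unfolding symplectic_form_def bilinear_def by blast+
  have zero: "\<omega> 0 w = 0" "\<omega> w 0 = 0" for w
    using linear_0[OF lin(1)] linear_0[OF lin(2)] by auto
  have add: "\<omega> (u + v) w = \<omega> u w + \<omega> v w" "\<omega> w (u + v) = \<omega> w u + \<omega> w v" for u v w
    using linear_add[OF lin(1)] linear_add[OF lin(2)] by auto
  have neg: "\<omega> (- v) v = 0" for v
    proof -
    have "\<omega> v v = 0" using anti[of v v] by linarith
    then show ?thesis using linear_neg[OF lin(1), of v v] by simp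
  qed
  show ?thesis
  proof (rule groupI)
    fix x y z :: "'a \<times> real"
    obtain u r v s w t where xyz: "x = (u, r)" "y = (v, s)" "z = (w, t)"
      by (cases x; cases y; cases z) blast
    show "x \<otimes>\<^bsub>heisenberg \<omega>\<^esub> y \<otimes>\<^bsub>heisenberg \<omega>\<^esub> z =
          x \<otimes>\<^bsub>heisenberg \<omega>\<^esub> (y \<otimes>\<^bsub>heisenberg \<omega>\<^esub> z)"
      by (simp add: xyz add add_divide_distrib)
    show "\<one>\<^bsub>heisenberg \<omega>\<^esub> \<otimes>\<^bsub>heisenberg \<omega>\<^esub> x = x"
      by (simp add: xyz zero)
    have "(- u, - r) \<otimes>\<^bsub>heisenberg \<omega>\<^esub> x = \<one>\<^bsub>heisenberg \<omega>\<^esub>"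
      by (simp add: xyz neg)
    then show "\<exists>y\<in>carrier (heisenberg \<omega>). y \<otimes>\<^bsub>heisenberg \<omega>\<^esub> x = \<one>\<^bsub>heisenberg \<omega>\<^esub>"
      by auto
  qed simp_all
qed

text \<open>The metric is an arbitrary left-invariant one, not necessarily proper, subject only
  to the requirement that it induces coordinatewise convergence.\<close>

definition heisenberg_metric ::
  "('v::real_normed_vector \<Rightarrow> 'v \<Rightarrow> real) \<Rightarrow> ('v \<times> real \<Rightarrow> 'v \<times> real \<Rightarrow> real) \<Rightarrow> bool" where
  "heisenberg_metric \<omega> d \<longleftrightarrow>
     Metric_space UNIV d \<and>
     (\<forall>g x y. d (g \<otimes>\<^bsub>heisenberg \<omega>\<^esub> x) (g \<otimes>\<^bsub>heisenberg \<omega>\<^esub> y) = d x y) \<and>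
     (\<forall>v z v' z'. limitin (Metric_space.mtopology UNIV d) (\<lambda>k::nat. (v k, z k)) (v', z') sequentially
        \<longleftrightarrow> (v \<longlonglongrightarrow> v') \<and> (z \<longlonglongrightarrow> z'))"

definition approximate_subgroup :: "('a, 'b) monoid_scheme \<Rightarrow> 'a set \<Rightarrow> bool" where
  "approximate_subgroup G \<Lambda> \<longleftrightarrow>
     \<Lambda> \<subseteq> carrier G \<and> \<one>\<^bsub>G\<^esub> \<in> \<Lambda> \<and> set_inv\<^bsub>G\<^esub> \<Lambda> = \<Lambda> \<and>
     (\<exists>F. finite F \<and> F \<subseteq> carrier G \<and> (set_inv\<^bsub>G\<^esub> \<Lambda>) <#>\<^bsub>G\<^esub> \<Lambda> \<subseteq> F <#>\<^bsub>G\<^esub> \<Lambda>)"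

text \<open>Discreteness is pointwise: the radius may depend on the point, and \<open>A\<close> need be
  neither closed nor uniformly discrete.\<close>

definition discrete_wrt :: "('a \<Rightarrow> 'a \<Rightarrow> real) \<Rightarrow> 'a set \<Rightarrow> bool" where
  "discrete_wrt d A \<longleftrightarrow> (\<forall>l\<in>A. \<exists>\<delta>>0. Metric_space.mcball UNIV d l \<delta> \<inter> A = {l})"

definition relatively_dense_around :: "('a \<Rightarrow> 'a \<Rightarrow> real) \<Rightarrow> 'a set \<Rightarrow> 'a set \<Rightarrow> bool" where
  "relatively_dense_around d \<Lambda> H \<longleftrightarrow>
     (\<exists>R>0. (\<forall>h\<in>H. Metric_space.mcball UNIV d h R \<inter> \<Lambda> \<noteq> {}) \<and>
            \<Lambda> \<subseteq> (\<Union>h\<in>H. Metric_space.mcball UNIV d h R))"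

end

theory Submission
  imports Defs "HOL-Library.Ramsey"
begin

text \<open>Write \<open>\<pi>\<close> for the projection \<open>fst\<close> onto \<open>V\<close>. Three ideas combine.

  First, a coarse version of Schreiber's theorem: in a Euclidean space every approximate subgroup \<open>A\<close>
  lies at bounded distance from a linear subspace, and the subspace at
  bounded distance from \<open>A\<close> (\<open>approximate_subgroup_near_subspace\<close>). The subspace is the limit of
  the rescaled sets \<open>A / 2^k\<close>.

  Second, this is applied to \<open>\<pi>(\<Lambda>)\<close>, which gives a subspace \<open>L\<close> of \<open>V\<close>, and two cases arise. If
  some \<open>y \<in> \<Lambda>\<close> has \<open>\<omega>(L, \<pi>(y)) \<noteq> 0\<close>, the commutators of \<open>y\<close> with \<open>\<Lambda>\<close> are central elements
  \<open>(0, c)\<close> in which \<open>c\<close> runs through a relatively dense set of reals. Products of boundedly many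
  elements of \<open>\<Lambda>\<close> are elements of \<open>\<Lambda>\<close> up to a finite error, so \<open>\<Lambda>\<close> is close to \<open>L \<times> \<real>\<close>
  (\<open>central_case\<close>). If \<open>\<omega>(L, \<pi>(\<Lambda>)) = 0\<close>, all commutators are bounded, so that
  \<open>\<Lambda>\<close> is an approximate subgroup of the vector space \<open>V \<times> \<real>\<close>, and the coarse Schreiber theorem
  gives a subspace of \<open>V \<times> \<real>\<close>, which turns out to be an abelian subgroup close to \<open>\<Lambda>\<close>
  (\<open>isotropic_case\<close>).

  Third, discreteness enters through local finiteness: a bounded set contains only finitely many
  elements of \<open>\<Lambda>\<close>, and only finitely many products of a fixed number of them
  (\<open>locally_finite\<close>, \<open>products_locally_finite\<close>). This makes the subgroup non-trivial when \<open>\<Lambda>\<close> is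
  infinite. It also makes \<open>\<pi>(\<Lambda>)\<close> discrete in the first case, the only one with a non-abelian
  subgroup: multiplying by a suitable commutator, every point of
  \<open>\<pi>(\<Lambda>)\<close> in a bounded set is the projection of a product of five elements of \<open>\<Lambda>\<close> in a bounded set.
  Since points of \<open>\<Lambda>\<close> are only assumed to be isolated one by one, local finiteness needs an argument
  of its own, based on Ramsey's theorem (\<open>no_convergent_sequence\<close>).

  A left-invariant metric appears only at the end: a bounded set of quotients \<open>h\<inverse>x\<close> has bounded
  diameter in every such metric, so the coarse statements transfer.\<close>

section \<open>Coarse structure of approximate subgroups of a Euclidean space\<close>

text \<open>Such a set is closed under multiplication by dyadic rationals, and these are dense.\<close>

lemma closed_halving_subgroup_imp_subspace:
  fixes L :: "'a::real_normed_vector set"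
  assumes zero: "0 \<in> L" and add: "\<And>u v. u \<in> L \<Longrightarrow> v \<in> L \<Longrightarrow> u + v \<in> L"
    and neg: "\<And>u. u \<in> L \<Longrightarrow> - u \<in> L" and half: "\<And>u. u \<in> L \<Longrightarrow> (1/2) *\<^sub>R u \<in> L"
    and "closed L"
  shows "subspace L"
proof -
  have nat: "real n *\<^sub>R v \<in> L" if "v \<in> L" for n v
    by (induction n) (auto simp: zero add that scaleR_left_distrib)
  have int: "real_of_int i *\<^sub>R v \<in> L" if "v \<in> L" for i v
  proof (cases "i \<ge> 0")
    case True
    then show ?thesis using nat[OF that, of "nat i"] by simp
  next
    case False
    then show ?thesis using neg[OF nat[OF that, of "nat (- i)"]] by simp
  qed
  have pow: "(1 / 2^k) *\<^sub>R v \<in> L" if "v \<in> L" for k :: nat and v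
  proof (induction k)
    case (Suc k)
    then show ?case using half[OF Suc] by simp
  qed (simp add: that)
  have "c *\<^sub>R v \<in> L" if v: "v \<in> L" for c v
  proof -
    define q where "q k = (real_of_int \<lfloor>c * 2^k\<rfloor> / 2^k) *\<^sub>R v" for k :: nat
    have q: "q k \<in> L" for k
      using pow[OF int[OF v, of "\<lfloor>c * 2^k\<rfloor>"], of k] by (simp add: q_def)
    have "norm (real_of_int \<lfloor>c * 2^k\<rfloor> / 2^k - c) \<le> (1/2)^k" for k :: nat
    proof -
      have "real_of_int \<lfloor>c * 2^k\<rfloor> / 2^k - c = (real_of_int \<lfloor>c * 2^k\<rfloor> - c * 2^k) / 2^k"
        by (simp add: field_simps)
      moreover have "\<bar>real_of_int \<lfloor>c * 2^k\<rfloor> - c * 2^k\<bar> \<le> 1" by linarith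
      ultimately show ?thesis by (simp add: power_one_over divide_right_mono)
    qed
    then have "(\<lambda>k. real_of_int \<lfloor>c * 2^k\<rfloor> / 2^k - c) \<longlonglongrightarrow> 0"
      by (intro Lim_null_comparison[OF always_eventually LIMSEQ_power_zero[of "1/2::real"]]) auto
    then have "(\<lambda>k. real_of_int \<lfloor>c * 2^k\<rfloor> / 2^k) \<longlonglongrightarrow> c"
      by (simp add: LIM_zero_iff)
    then have "q \<longlonglongrightarrow> c *\<^sub>R v"
      unfolding q_def by (intro tendsto_intros)
    then show ?thesis
      using closed_sequentially[OF \<open>closed L\<close>, of q] q by blast
  qed
  then show ?thesis
    by (simp add: subspace_def zero add)
qed

text \<open>The subspace \<open>L\<close> consists of the vectors \<open>v\<close> that are limits of points \<open>a\<^sub>k / 2^k\<close> with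
  \<open>a\<^sub>k \<in> A\<close>. Rescaling makes the bounded error \<open>r\<close> vanish, so \<open>L\<close> is a closed group; it admits halving
  because the scales \<open>2^k\<close> do. Each \<open>a \<in> A\<close> is close to a point of \<open>L\<close> by repeated approximate
  doubling. Conversely, compactness of the unit ball of \<open>L\<close> gives one scale at which \<open>A\<close> is dense
  enough in \<open>L\<close>, and an approximation of \<open>x/2\<close> can be doubled and then corrected at that scale to
  an approximation of \<open>x\<close> of the same quality.\<close>

theorem approximate_subgroup_near_subspace:
  fixes A :: "'a::euclidean_space set"
  assumes zero: "0 \<in> A" and neg: "\<And>a. a \<in> A \<Longrightarrow> - a \<in> A"
    and add: "\<And>a b. a \<in> A \<Longrightarrow> b \<in> A \<Longrightarrow> \<exists>c\<in>A. norm (a + b - c) \<le> r"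
  obtains L R where "subspace L" "\<And>a. a \<in> A \<Longrightarrow> \<exists>l\<in>L. norm (a - l) \<le> R"
    "\<And>l. l \<in> L \<Longrightarrow> \<exists>a\<in>A. norm (l - a) \<le> R"
proof -
  have "r \<ge> 0" using add[OF zero zero] norm_ge_zero order_trans by blast
  define near where "near v \<epsilon> k \<longleftrightarrow> (\<exists>a\<in>A. norm (v - (1/2^k) *\<^sub>R a) \<le> \<epsilon>)" for v \<epsilon> and k :: nat
  define L where "L = {v. \<forall>\<epsilon>>0. \<exists>N. \<forall>k\<ge>N. near v \<epsilon> k}"
  have small: "\<exists>N. \<forall>k\<ge>N. r / 2^k \<le> \<epsilon>" if "\<epsilon> > 0" for \<epsilon>
  proof -
    have "(\<lambda>k. r * (1/2)^k) \<longlonglongrightarrow> r * 0"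
      by (intro tendsto_intros LIMSEQ_power_zero) auto
    then have "eventually (\<lambda>k. r * (1/2)^k < \<epsilon>) sequentially"
      using that by (intro order_tendstoD) auto
    then show ?thesis
      by (auto simp: eventually_sequentially power_one_over intro: less_imp_le)
  qed
  have "subspace L"
  proof (rule closed_halving_subgroup_imp_subspace)
    show "0 \<in> L" unfolding L_def near_def using zero by force
    show "u + v \<in> L" if "u \<in> L" "v \<in> L" for u v
      unfolding L_def
    proof (rule CollectI, intro allI impI)
      fix \<epsilon> :: real assume "\<epsilon> > 0"
      then have "\<epsilon>/3 > 0" by simp
      obtain N1 where N1: "\<And>k. k \<ge> N1 \<Longrightarrow> near u (\<epsilon>/3) k"
        using \<open>u \<in> L\<close> \<open>\<epsilon>/3 > 0\<close> unfolding L_def by blast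
      obtain N2 where N2: "\<And>k. k \<ge> N2 \<Longrightarrow> near v (\<epsilon>/3) k"
        using \<open>v \<in> L\<close> \<open>\<epsilon>/3 > 0\<close> unfolding L_def by blast
      obtain N3 where N3: "\<And>k. k \<ge> N3 \<Longrightarrow> r / 2^k \<le> \<epsilon>/3"
        using small[OF \<open>\<epsilon>/3 > 0\<close>] by blast
      have "near (u + v) \<epsilon> k" if k: "k \<ge> N1 + N2 + N3" for k
      proof -
        obtain a where a: "a \<in> A" "norm (u - (1/2^k) *\<^sub>R a) \<le> \<epsilon>/3"
          using N1[of k] k unfolding near_def by auto
        obtain b where b: "b \<in> A" "norm (v - (1/2^k) *\<^sub>R b) \<le> \<epsilon>/3"
          using N2[of k] k unfolding near_def by auto
        obtain c where c: "c \<in> A" "norm (a + b - c) \<le> r" using add[OF a(1) b(1)] by blast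
        have "norm ((1/2^k) *\<^sub>R (a + b - c)) \<le> r / 2^k"
          using c(2) by (simp add: divide_right_mono)
        also have "\<dots> \<le> \<epsilon>/3" using N3[of k] k by simp
        finally have *: "norm ((1/2^k) *\<^sub>R (a + b - c)) \<le> \<epsilon>/3" .
        have "u + v - (1/2^k) *\<^sub>R c
          = (u - (1/2^k) *\<^sub>R a) + (v - (1/2^k) *\<^sub>R b) + (1/2^k) *\<^sub>R (a + b - c)"
          by (simp add: algebra_simps)
        also have "norm \<dots> \<le> \<epsilon>/3 + \<epsilon>/3 + \<epsilon>/3"
          by (intro norm_triangle_le add_mono a(2) b(2) *)
        finally show ?thesis unfolding near_def using c(1) by auto
      qed
      then show "\<exists>N. \<forall>k\<ge>N. near (u + v) \<epsilon> k" by blast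
    qed
    show "- u \<in> L" if "u \<in> L" for u
    proof -
      have "near (- u) \<epsilon> k" if u: "near u \<epsilon> k" for \<epsilon> k
      proof -
        obtain a where a: "a \<in> A" "norm (u - (1/2^k) *\<^sub>R a) \<le> \<epsilon>" using u unfolding near_def by auto
        have "- u - (1/2^k) *\<^sub>R (- a) = - (u - (1/2^k) *\<^sub>R a)" by simp
        then have "norm (- u - (1/2^k) *\<^sub>R (- a)) \<le> \<epsilon>" using a(2) by (metis norm_minus_cancel)
        then show ?thesis unfolding near_def using neg[OF a(1)] by blast
      qed
      then show ?thesis using that unfolding L_def by blast
    qed
    show "(1/2) *\<^sub>R u \<in> L" if "u \<in> L" for u
      unfolding L_def
    proof (rule CollectI, intro allI impI)
      fix \<epsilon> :: real assume "\<epsilon> > 0"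
      then obtain N where N: "\<And>k. k \<ge> N \<Longrightarrow> near u \<epsilon> k"
        using \<open>u \<in> L\<close> unfolding L_def by blast
      have "near ((1/2) *\<^sub>R u) \<epsilon> k" if k: "k \<ge> Suc N" for k
      proof -
        obtain j where j: "k = Suc j" "j \<ge> N" using k by (cases k) auto
        obtain a where a: "a \<in> A" "norm (u - (1/2^j) *\<^sub>R a) \<le> \<epsilon>"
          using N[OF j(2)] unfolding near_def by auto
        have "(1/2) *\<^sub>R u - (1/2^k) *\<^sub>R a = (1/2) *\<^sub>R (u - (1/2^j) *\<^sub>R a)"
          by (simp add: j algebra_simps)
        also have "norm \<dots> \<le> \<epsilon>" using a(2) \<open>\<epsilon> > 0\<close> by simp
        finally show ?thesis using a(1) unfolding near_def by auto
      qed
      then show "\<exists>N. \<forall>k\<ge>N. near ((1/2) *\<^sub>R u) \<epsilon> k" by blast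
    qed
    show "closed L"
      unfolding closed_sequential_limits
    proof (intro allI impI)
      fix x l assume x: "(\<forall>n. x n \<in> L) \<and> x \<longlonglongrightarrow> l"
      show "l \<in> L"
        unfolding L_def
      proof (rule CollectI, intro allI impI)
        fix \<epsilon> :: real assume "\<epsilon> > 0"
        then have "\<epsilon>/2 > 0" by simp
        then obtain n where n: "norm (l - x n) < \<epsilon>/2"
          using x LIMSEQ_iff[of x l] by (metis norm_minus_commute order_refl)
        obtain N where N: "\<And>k. k \<ge> N \<Longrightarrow> near (x n) (\<epsilon>/2) k"
          using x \<open>\<epsilon>/2 > 0\<close> unfolding L_def by blast
        have "near l \<epsilon> k" if k: "k \<ge> N" for k
        proof -
          obtain a where a: "a \<in> A" "norm (x n - (1/2^k) *\<^sub>R a) \<le> \<epsilon>/2"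
            using N[OF k] unfolding near_def by auto
          have "norm (l - (1/2^k) *\<^sub>R a) \<le> \<epsilon>/2 + \<epsilon>/2"
            using norm_triangle_le[of "l - x n" "x n - (1/2^k) *\<^sub>R a" "\<epsilon>/2 + \<epsilon>/2"] n a(2) by simp
          then show ?thesis using a(1) unfolding near_def by auto
        qed
        then show "\<exists>N. \<forall>k\<ge>N. near l \<epsilon> k" by blast
      qed
    qed
  qed

  have A_near_L: "\<exists>l\<in>L. norm (a - l) \<le> r" if "a \<in> A" for a
  proof -
    \<comment> \<open>Approximate doubling: \<open>b\<^sub>0 = a\<close> and \<open>b\<^sub>k\<^sub>+\<^sub>1\<close> is within \<open>r\<close> of \<open>2 b\<^sub>k\<close>, so \<open>b\<^sub>k / 2^k\<close> moves by at
      most \<open>r / 2^(k+1)\<close> per step and in total by at most \<open>r\<close>.\<close>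
    have "\<forall>b. \<exists>c. b \<in> A \<longrightarrow> c \<in> A \<and> norm (b + b - c) \<le> r" using add by blast
    from choice[OF this] obtain D where D: "\<forall>b. b \<in> A \<longrightarrow> D b \<in> A \<and> norm (b + b - D b) \<le> r" ..
    define b where "b k = (D ^^ k) a" for k
    have bA: "b k \<in> A" for k by (induction k) (auto simp: b_def that D)
    define u where "u k = (1/2^k) *\<^sub>R b k" for k
    have step: "norm (u (Suc k) - u k) \<le> r / 2^k - r / 2^(Suc k)" for k
    proof -
      have "u (Suc k) - u k = - ((1/2^(Suc k)) *\<^sub>R (b k + b k - D (b k)))"
        by (simp add: u_def b_def algebra_simps flip: scaleR_2)
      also have "norm \<dots> \<le> r / 2^(Suc k)"
        using D bA[of k] by (simp add: divide_right_mono del: power_Suc)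
      also have "\<dots> = r / 2^k - r / 2^(Suc k)" by (simp add: field_simps)
      finally show ?thesis .
    qed
    have tele: "norm (u (k + j) - u k) \<le> r / 2^k - r / 2^(k + j)" for k j
    proof (induction j)
      case (Suc j)
      have "norm (u (k + Suc j) - u k) \<le> norm (u (Suc (k + j)) - u (k + j)) + norm (u (k + j) - u k)"
        using norm_triangle_ineq[of "u (Suc (k + j)) - u (k + j)" "u (k + j) - u k"] by simp
      also have "\<dots> \<le> r / 2^k - r / 2^(k + Suc j)" using Suc step[of "k + j"] by simp
      finally show ?case .
    qed simp
    have bound: "norm (u n - u k) \<le> r / 2^k" if "n \<ge> k" for n k
    proof -
      have "norm (u n - u k) \<le> r / 2^k - r / 2^n" using tele[of k "n - k"] that by simp
      moreover have "r / 2^n \<ge> 0" using \<open>r \<ge> 0\<close> by simp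
      ultimately show ?thesis by linarith
    qed
    have "Cauchy u"
    proof (rule CauchyI')
      fix e :: real assume "e > 0"
      then obtain N where N: "\<And>k. k \<ge> N \<Longrightarrow> r / 2^k \<le> e/2" using small[of "e/2"] by auto
      have "dist (u m) (u n) < e" if "m \<ge> N" "n > m" for m n
      proof -
        have "norm (u n - u m) \<le> r / 2^m" using bound that(2) by simp
        also have "\<dots> \<le> e/2" using N that(1) by blast
        finally show ?thesis using \<open>e > 0\<close> by (simp add: dist_norm norm_minus_commute)
      qed
      then show "\<exists>M. \<forall>m\<ge>M. \<forall>n>m. dist (u m) (u n) < e" by blast
    qed
    then obtain v where v: "u \<longlonglongrightarrow> v" using Cauchy_convergent_iff convergent_def by blast
    have vb: "norm (v - u k) \<le> r / 2^k" for k
    proof (rule tendsto_upperbound)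
      show "(\<lambda>n. norm (u n - u k)) \<longlonglongrightarrow> norm (v - u k)" by (intro tendsto_intros v)
      show "eventually (\<lambda>n. norm (u n - u k) \<le> r / 2^k) sequentially"
        using bound eventually_sequentially by blast
    qed simp
    have "near v \<epsilon> k" if "r / 2^k \<le> \<epsilon>" for \<epsilon> k
      unfolding near_def using bA[of k] vb[of k] that by (force simp: u_def)
    then have "v \<in> L" unfolding L_def using small by blast
    moreover have "norm (a - v) \<le> r"
      using vb[of 0] by (simp add: u_def b_def norm_minus_commute)
    ultimately show ?thesis by blast
  qed

  \<comment> \<open>Choose a scale \<open>\<rho>\<close> at which \<open>A\<close> is \<open>\<rho>/8\<close>-dense in the ball of radius \<open>\<rho>\<close> of \<open>L\<close>, and which is
    large compared to \<open>r\<close>.\<close>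
  have "compact (L \<inter> cball 0 1)"
    using closed_subspace[OF \<open>subspace L\<close>] by (simp add: closed_Int_compact)
  moreover have "L \<inter> cball 0 1 \<subseteq> (\<Union>v\<in>L \<inter> cball 0 1. ball v (1/16))" by force
  ultimately obtain V where V: "V \<subseteq> L \<inter> cball 0 1" "finite V"
      "L \<inter> cball 0 1 \<subseteq> (\<Union>v\<in>V. ball v (1/16))"
    by (metis (no_types, lifting) compactE_image open_ball)
  have "eventually (\<lambda>k. \<forall>v\<in>V. near v (1/16) k) sequentially"
    unfolding eventually_ball_finite_distrib[OF V(2)]
    using V(1) by (force simp: L_def eventually_sequentially)
  moreover obtain N0 where N0: "\<And>k. k \<ge> N0 \<Longrightarrow> r / 2^k \<le> 1/32" using small[of "1/32"] by auto
  ultimately obtain N where N: "N \<ge> N0" "\<forall>v\<in>V. near v (1/16) N"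
    unfolding eventually_sequentially by (metis nle_le)
  define \<rho> :: real where "\<rho> = 2^N"
  have "\<rho> > 0" by (simp add: \<rho>_def)
  have r\<rho>: "r \<le> \<rho>/32" using N0[OF N(1)] by (simp add: \<rho>_def field_simps)
  have scale: "\<exists>a\<in>A. norm (y - a) \<le> \<rho>/8" if y: "y \<in> L" "norm y \<le> \<rho>" for y
  proof -
    have "(1/\<rho>) *\<^sub>R y \<in> L \<inter> cball 0 1"
      using y \<open>\<rho> > 0\<close> \<open>subspace L\<close> by (simp add: subspace_scale)
    then obtain v where v: "v \<in> V" "norm (v - (1/\<rho>) *\<^sub>R y) < 1/16"
      using V(3) by (auto simp: dist_norm)
    obtain a where a: "a \<in> A" "norm (v - (1/\<rho>) *\<^sub>R a) \<le> 1/16"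
      using N(2) v(1) unfolding near_def \<rho>_def by auto
    have "y - a = \<rho> *\<^sub>R ((v - (1/\<rho>) *\<^sub>R a) - (v - (1/\<rho>) *\<^sub>R y))"
      using \<open>\<rho> > 0\<close> by (simp add: algebra_simps)
    also have "norm \<dots> \<le> \<rho> * (1/16 + 1/16)"
      using \<open>\<rho> > 0\<close> norm_triangle_ineq4[of "v - (1/\<rho>) *\<^sub>R a" "v - (1/\<rho>) *\<^sub>R y"] a(2) v(2)
      by simp
    finally show ?thesis using a(1) by auto
  qed
  have L_near_A: "\<exists>a\<in>A. norm (x - a) \<le> \<rho>/4" if "x \<in> L" "norm x \<le> 2^n * (\<rho>/4)" for x n
    using that
  proof (induction n arbitrary: x)
    case 0
    then show ?case using zero by (intro bexI[of _ 0]) auto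
  next
    case (Suc n)
    have "(1/2) *\<^sub>R x \<in> L" using Suc.prems(1) \<open>subspace L\<close> by (simp add: subspace_scale)
    moreover have "norm ((1/2) *\<^sub>R x) \<le> 2^n * (\<rho>/4)" using Suc.prems(2) by (simp add: mult.commute)
    ultimately obtain a where a: "a \<in> A" "norm ((1/2) *\<^sub>R x - a) \<le> \<rho>/4"
      using Suc.IH by blast
    obtain l where l: "l \<in> L" "norm (a - l) \<le> r" using A_near_L[OF a(1)] by blast
    \<comment> \<open>The doubled error \<open>x - 2a\<close> need not lie in \<open>L\<close>, so \<open>a\<close> is replaced by its neighbour \<open>l \<in> L\<close>.
      The final error is at most \<open>\<rho>/8 + 4r \<le> \<rho>/4\<close>.\<close>
    define y where "y = x - 2 *\<^sub>R l"
    have "y \<in> L"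
      unfolding y_def using Suc.prems(1) l(1) \<open>subspace L\<close> by (simp add: subspace_diff subspace_scale)
    have "y = 2 *\<^sub>R (((1/2) *\<^sub>R x - a) + (a - l))" by (simp add: y_def algebra_simps)
    also have "norm \<dots> \<le> 2 * (\<rho>/4 + r)"
      using norm_triangle_ineq[of "(1/2) *\<^sub>R x - a" "a - l"] a(2) l(2) by simp
    finally have "norm y \<le> \<rho>" using r\<rho> \<open>\<rho> > 0\<close> by simp
    then obtain b where b: "b \<in> A" "norm (y - b) \<le> \<rho>/8" using scale \<open>y \<in> L\<close> by blast
    obtain c where c: "c \<in> A" "norm (a + a - c) \<le> r" using add[OF a(1) a(1)] by blast
    obtain e where e: "e \<in> A" "norm (b + c - e) \<le> r" using add[OF b(1) c(1)] by blast
    have "x - e = (y - b) - 2 *\<^sub>R (a - l) + (a + a - c) + (b + c - e)"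
      by (simp add: y_def algebra_simps scaleR_2)
    also have "norm \<dots> \<le> norm (y - b) + norm (2 *\<^sub>R (a - l)) + norm (a + a - c) + norm (b + c - e)"
      by norm
    also have "\<dots> \<le> \<rho>/8 + 2 * r + r + r"
      by (intro add_mono) (use b c e l in auto)
    also have "\<dots> \<le> \<rho>/4" using r\<rho> by simp
    finally show ?case using e(1) by blast
  qed
  show ?thesis
  proof (rule that[OF \<open>subspace L\<close>, of "\<rho>/4"])
    show "\<exists>l\<in>L. norm (a - l) \<le> \<rho>/4" if "a \<in> A" for a
      using A_near_L[OF that] r\<rho> \<open>\<rho> > 0\<close> by force
    show "\<exists>a\<in>A. norm (l - a) \<le> \<rho>/4" if "l \<in> L" for l
    proof -
      obtain n where "norm l / (\<rho>/4) < 2^n" using real_arch_pow[of 2] by auto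
      then have "norm l \<le> 2^n * (\<rho>/4)" using \<open>\<rho> > 0\<close> by (simp add: field_simps)
      then show ?thesis using L_near_A that by blast
    qed
  qed
qed

section \<open>The Heisenberg group\<close>

locale heisenberg_space =
  fixes \<omega> :: "'v::euclidean_space \<Rightarrow> 'v \<Rightarrow> real"
  assumes bilinear: "bounded_bilinear \<omega>" and alternating: "\<omega> v v = 0"
begin

definition mul :: "'v \<times> real \<Rightarrow> 'v \<times> real \<Rightarrow> 'v \<times> real" (infixl "\<cdot>" 70)
  where "x \<cdot> y = (fst x + fst y, snd x + snd y + \<omega> (fst x) (fst y) / 2)"

lemmas \<omega>_simps =
  bounded_bilinear.add_left[OF bilinear] bounded_bilinear.add_right[OF bilinear]
  bounded_bilinear.minus_left[OF bilinear] bounded_bilinear.minus_right[OF bilinear]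
  bounded_bilinear.diff_left[OF bilinear] bounded_bilinear.diff_right[OF bilinear]
  bounded_bilinear.zero_left[OF bilinear] bounded_bilinear.zero_right[OF bilinear]
  bounded_bilinear.scaleR_left[OF bilinear] bounded_bilinear.scaleR_right[OF bilinear]

lemma antisymmetric: "\<omega> v w = - \<omega> w v"
proof -
  have "\<omega> (v + w) (v + w) = \<omega> v w + \<omega> w v"
    unfolding \<omega>_simps by (simp add: alternating)
  then show ?thesis by (simp add: alternating)
qed

lemma mul_assoc: "(x \<cdot> y) \<cdot> z = x \<cdot> (y \<cdot> z)"
  by (simp add: mul_def \<omega>_simps add_divide_distrib)

lemma mul_zero [simp]: "0 \<cdot> x = x" "x \<cdot> 0 = x"
  by (simp_all add: mul_def \<omega>_simps)

lemma mul_neg [simp]: "- x \<cdot> x = 0" "x \<cdot> - x = 0"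
  by (simp_all add: mul_def \<omega>_simps alternating zero_prod_def)

lemma mul_neg_cancel [simp]: "- x \<cdot> (x \<cdot> y) = y" "x \<cdot> (- x \<cdot> y) = y"
  by (simp_all flip: mul_assoc)

lemma neg_mul: "- (x \<cdot> y) = - y \<cdot> - x"
  using antisymmetric[of "fst x" "fst y"] by (simp add: mul_def \<omega>_simps)

lemma mul_right_cancel [simp]: "x \<cdot> z = y \<cdot> z \<longleftrightarrow> x = y"
  by (metis mul_assoc mul_neg(2) mul_zero(2))

lemma mul_left_cancel [simp]: "z \<cdot> x = z \<cdot> y \<longleftrightarrow> x = y"
  by (metis mul_neg_cancel(1))

lemma fst_mul [simp]: "fst (x \<cdot> y) = fst x + fst y"
  by (simp add: mul_def)

lemma tendsto_mul [tendsto_intros]: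
  assumes "(f \<longlongrightarrow> a) F" "(g \<longlongrightarrow> b) F"
  shows "((\<lambda>x. f x \<cdot> g x) \<longlongrightarrow> a \<cdot> b) F"
  unfolding mul_def
  by (intro tendsto_intros assms bounded_bilinear.tendsto[OF bilinear]) simp

lemma continuous_on_mul:
  "continuous_on S f \<Longrightarrow> continuous_on S g \<Longrightarrow> continuous_on S (\<lambda>x. f x \<cdot> g x)"
  unfolding continuous_on_def by (blast intro: tendsto_mul)

lemma bounded_mul:
  assumes "bounded S" "bounded T"
  shows "bounded ((\<lambda>(x, y). x \<cdot> y) ` (S \<times> T))"
proof -
  have "compact ((\<lambda>p. fst p \<cdot> snd p) ` (closure S \<times> closure T))"
    using assms by (intro compact_continuous_image continuous_on_mul compact_Times)
      (auto intro!: continuous_intros)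
  then have "bounded ((\<lambda>p. fst p \<cdot> snd p) ` (closure S \<times> closure T))"
    by (rule compact_imp_bounded)
  moreover have "(\<lambda>(x, y). x \<cdot> y) ` (S \<times> T) \<subseteq> (\<lambda>p. fst p \<cdot> snd p) ` (closure S \<times> closure T)"
    unfolding case_prod_beta by (intro image_mono Sigma_mono closure_subset)
  ultimately show ?thesis by (rule bounded_subset)
qed

definition list_mul :: "('v \<times> real) list \<Rightarrow> 'v \<times> real"
  where "list_mul xs = foldr (\<cdot>) xs 0"

lemma list_mul_simps [simp]: "list_mul [] = 0" "list_mul (x # xs) = x \<cdot> list_mul xs"
  by (simp_all add: list_mul_def)

lemma list_mul_append [simp]: "list_mul (xs @ ys) = list_mul xs \<cdot> list_mul ys"
  by (induction xs) (simp_all add: mul_assoc)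

end

section \<open>Discrete approximate subgroups are locally finite\<close>

text \<open>With the finitely many error factors \<open>f\<close> on the right, products of \<open>k\<close> elements reduce one
  factor at a time: \<open>x \<cdot> (l \<cdot> f) = (x \<cdot> l) \<cdot> f\<close>, and \<open>x \<cdot> l\<close> is again covered.\<close>

locale discrete_approximate_subgroup = heisenberg_space \<omega>
  for \<omega> :: "'v::euclidean_space \<Rightarrow> 'v \<Rightarrow> real" +
  fixes \<Lambda> :: "('v \<times> real) set"
  assumes zero: "0 \<in> \<Lambda>" and neg: "x \<in> \<Lambda> \<Longrightarrow> - x \<in> \<Lambda>"
    and cover: "\<exists>F. finite F \<and> (\<forall>x\<in>\<Lambda>. \<forall>y\<in>\<Lambda>. \<exists>l\<in>\<Lambda>. \<exists>f\<in>F. x \<cdot> y = l \<cdot> f)"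
    and discrete: "l \<in> \<Lambda> \<Longrightarrow> \<not> l islimpt \<Lambda>"
begin

lemma list_mul_cover:
  "\<exists>F. finite F \<and>
    (\<forall>xs. length xs = k \<and> set xs \<subseteq> \<Lambda> \<longrightarrow> (\<exists>l\<in>\<Lambda>. \<exists>f\<in>F. list_mul xs = l \<cdot> f))"
proof (induction k)
  case 0
  then show ?case using zero by (intro exI[of _ "{0}"]) auto
next
  case (Suc k)
  then obtain F where F: "finite F"
    "\<And>xs. length xs = k \<and> set xs \<subseteq> \<Lambda> \<Longrightarrow> \<exists>l\<in>\<Lambda>. \<exists>f\<in>F. list_mul xs = l \<cdot> f" by blast
  obtain G where G: "finite G" "\<And>x y. x \<in> \<Lambda> \<Longrightarrow> y \<in> \<Lambda> \<Longrightarrow> \<exists>l\<in>\<Lambda>. \<exists>g\<in>G. x \<cdot> y = l \<cdot> g"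
    using cover by blast
  have "\<exists>l\<in>\<Lambda>. \<exists>h\<in>(\<lambda>(g, f). g \<cdot> f) ` (G \<times> F). list_mul xs = l \<cdot> h"
    if len: "length xs = Suc k" and sub: "set xs \<subseteq> \<Lambda>" for xs
  proof -
    obtain x ys where xs: "xs = x # ys" using len by (cases xs) auto
    obtain l f where lf: "l \<in> \<Lambda>" "f \<in> F" "list_mul ys = l \<cdot> f"
      using F(2)[of ys] len sub xs by auto
    obtain l' g where "l' \<in> \<Lambda>" "g \<in> G" "x \<cdot> l = l' \<cdot> g"
      using G(2)[of x l] lf(1) sub xs by auto
    then have "list_mul xs = l' \<cdot> (g \<cdot> f)"
      using lf(3) by (simp add: xs flip: mul_assoc)
    then show ?thesis using \<open>l' \<in> \<Lambda>\<close> \<open>g \<in> G\<close> lf(2) by auto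
  qed
  moreover have "finite ((\<lambda>(g, f). g \<cdot> f) ` (G \<times> F))" using F(1) G(1) by simp
  ultimately show ?case by blast
qed

lemma translate_discrete:
  assumes "l \<in> \<Lambda>"
  shows "\<not> (l \<cdot> f) islimpt (\<lambda>y. y \<cdot> f) ` \<Lambda>"
proof
  assume "(l \<cdot> f) islimpt (\<lambda>y. y \<cdot> f) ` \<Lambda>"
  then obtain u where u: "\<forall>n. u n \<in> (\<lambda>y. y \<cdot> f) ` \<Lambda> - {l \<cdot> f}" "u \<longlonglongrightarrow> l \<cdot> f"
    unfolding islimpt_sequential by blast
  have "\<forall>n. u n \<cdot> - f \<in> \<Lambda> - {l}"
  proof
    show "u n \<cdot> - f \<in> \<Lambda> - {l}" for n
      using u(1)[rule_format, of n] by (auto simp: mul_assoc)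
  qed
  moreover have "(\<lambda>n. u n \<cdot> - f) \<longlonglongrightarrow> l \<cdot> f \<cdot> - f"
    by (rule tendsto_mul[OF u(2) tendsto_const])
  then have "(\<lambda>n. u n \<cdot> - f) \<longlonglongrightarrow> l" by (simp add: mul_assoc)
  ultimately have "l islimpt \<Lambda>"
    unfolding islimpt_sequential by (intro exI[of _ "\<lambda>n. u n \<cdot> - f"] conjI)
  then show False using discrete[OF assms] by blast
qed

text \<open>A product of \<open>m\<close> elements lies in one of finitely many translates of \<open>\<Lambda>\<close>. Colouring the
  \<open>m\<close>-element index sets by the translate that contains the corresponding product, Ramsey's
  theorem provides a subsequence whose increasing products all share one translate. Quotients of
  two such products are then quotients of two elements of \<open>\<Lambda>\<close>, no matter how large \<open>m\<close> is.\<close>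

lemma increasing_products_in_one_translate:
  assumes "range x \<subseteq> \<Lambda>"
  shows "\<exists>s f. strict_mono (s :: nat \<Rightarrow> nat) \<and> (\<forall>js. sorted_wrt (<) js \<and> length js = m \<longrightarrow>
    (\<exists>l\<in>\<Lambda>. list_mul (map (x \<circ> s) js) = l \<cdot> f))"
proof -
  obtain F where F: "finite F"
    "\<forall>xs. length xs = m \<and> set xs \<subseteq> \<Lambda> \<longrightarrow> (\<exists>l\<in>\<Lambda>. \<exists>f\<in>F. list_mul xs = l \<cdot> f)"
    using list_mul_cover[of m] by blast
  obtain h where h: "bij_betw h {0..<card F} F" using ex_bij_betw_nat_finite[OF F(1)] by blast
  have "\<forall>X. \<exists>i. finite X \<and> card X = m \<longrightarrow>
      i < card F \<and> (\<exists>l\<in>\<Lambda>. list_mul (map x (sorted_list_of_set X)) = l \<cdot> h i)"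
  proof (intro allI)
    fix X :: "nat set"
    have "\<exists>i<card F. \<exists>l\<in>\<Lambda>. list_mul (map x (sorted_list_of_set X)) = l \<cdot> h i"
      if X: "finite X" "card X = m"
    proof -
      have "set (map x (sorted_list_of_set X)) \<subseteq> \<Lambda>" using assms by auto
      then obtain l f where lf: "l \<in> \<Lambda>" "f \<in> F" "list_mul (map x (sorted_list_of_set X)) = l \<cdot> f"
        using F(2)[rule_format, of "map x (sorted_list_of_set X)"] X by auto
      moreover obtain i where "i < card F" "f = h i"
        using h lf(2) by (force simp: bij_betw_def)
      ultimately show ?thesis by blast
    qed
    then show "\<exists>i. finite X \<and> card X = m \<longrightarrow>
      i < card F \<and> (\<exists>l\<in>\<Lambda>. list_mul (map x (sorted_list_of_set X)) = l \<cdot> h i)" by blast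
  qed
  from choice[OF this] obtain c where c: "\<forall>X. finite X \<and> card X = m \<longrightarrow>
      c X < card F \<and> (\<exists>l\<in>\<Lambda>. list_mul (map x (sorted_list_of_set X)) = l \<cdot> h (c X))" ..
  obtain Y t where Y: "infinite Y" "\<forall>X. X \<subseteq> Y \<and> finite X \<and> card X = m \<longrightarrow> c X = t"
    using Ramsey[of "UNIV :: nat set" m c "card F"] c by auto
  have mono: "strict_mono (enumerate Y)" by (rule strict_mono_enumerate[OF Y(1)])
  show ?thesis
  proof (intro exI[of _ "enumerate Y"] exI[of _ "h t"] conjI allI impI mono)
    fix js :: "nat list" assume js: "sorted_wrt (<) js \<and> length js = m"
    define ks where "ks = map (enumerate Y) js"
    have ks: "sorted_wrt (<) ks"
      unfolding ks_def sorted_wrt_map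
      by (rule sorted_wrt_mono_rel[OF _ conjunct1[OF js]]) (use mono in \<open>auto simp: strict_mono_def\<close>)
    then have "sorted_list_of_set (set ks) = ks"
      by (simp add: sorted_list_of_set.idem_if_sorted_distinct strict_sorted_iff)
    moreover have "card (set ks) = m"
      using ks js by (simp add: distinct_card strict_sorted_iff ks_def[THEN arg_cong, of length])
    moreover have "set ks \<subseteq> Y" using Y(1) by (auto simp: ks_def enumerate_in_set)
    ultimately show "\<exists>l\<in>\<Lambda>. list_mul (map (x \<circ> enumerate Y) js) = l \<cdot> h t"
      using c[rule_format, of "set ks"] Y(2) by (auto simp: ks_def)
  qed
qed

text \<open>Quotients of two elements of \<open>\<Lambda>\<close> lie in \<open>m\<close> translates \<open>\<Lambda> \<cdot> f\<close>, each of them discrete. After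
  passing to a subsequence as above, the points
  \<open>w = x i\<^sub>1 \<cdots> x i\<^sub>t (x j\<^sub>1 \<cdots> x j\<^sub>t)\<inverse>\<close> with \<open>t \<le> m\<close> are such quotients: append a common tail to both index
  lists, which cancels. If \<open>x\<close> converges, appending two late neighbouring indices moves \<open>w\<close>
  by an arbitrarily small but nonzero amount. As \<open>w\<close> is isolated in the translate that contains it,
  a small enough move leaves that translate, together with a neighbourhood, while still
  avoiding the translates left before. After \<open>m\<close> moves no translate remains.\<close>

lemma no_convergent_sequence:
  assumes x: "range x \<subseteq> \<Lambda>" "inj x"
  shows "\<not> x \<longlonglongrightarrow> a"
proof
  assume lim: "x \<longlonglongrightarrow> a"
  obtain F where F: "finite F" "\<And>x y. x \<in> \<Lambda> \<Longrightarrow> y \<in> \<Lambda> \<Longrightarrow> \<exists>l\<in>\<Lambda>. \<exists>f\<in>F. x \<cdot> y = l \<cdot> f"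
    using cover by blast
  define m where "m = card F"
  obtain s :: "nat \<Rightarrow> nat" and g where s: "strict_mono s"
    "\<forall>js. sorted_wrt (<) js \<and> length js = m \<longrightarrow> (\<exists>l\<in>\<Lambda>. list_mul (map (x \<circ> s) js) = l \<cdot> g)"
    using increasing_products_in_one_translate[OF x(1), of m] by blast
  define p where "p is = list_mul (map (x \<circ> s) is)" for "is"
  \<comment> \<open>The common tail \<open>ts\<close> brings both lists to length \<open>m\<close>.\<close>
  have quot: "\<exists>l\<in>\<Lambda>. \<exists>f\<in>F. p is \<cdot> - p js = l \<cdot> f"
    if sorted: "sorted_wrt (<) is" "sorted_wrt (<) js"
      and len: "length is = length js" "length js \<le> m" for "is" js
  proof -
    define N where "N = Suc (Max (insert 0 (set is \<union> set js)))"
    have N: "i < N" if "i \<in> set is \<union> set js" for i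
      unfolding N_def less_Suc_eq_le using that by (intro Max_ge) auto
    define ts where "ts = [N..<N + (m - length js)]"
    have "sorted_wrt (<) (is @ ts)" "sorted_wrt (<) (js @ ts)"
      using sorted N by (force simp: ts_def sorted_wrt_append)+
    moreover have "length (is @ ts) = m" "length (js @ ts) = m" using len by (auto simp: ts_def)
    ultimately obtain l l' where l: "l \<in> \<Lambda>" "p (is @ ts) = l \<cdot> g" "l' \<in> \<Lambda>" "p (js @ ts) = l' \<cdot> g"
      using s(2)[rule_format, of "is @ ts"] s(2)[rule_format, of "js @ ts"] unfolding p_def by blast
    have "p is \<cdot> - p js = p (is @ ts) \<cdot> - p (js @ ts)"
      by (simp add: p_def neg_mul mul_assoc)
    also have "\<dots> = l \<cdot> - l'" by (simp add: l neg_mul mul_assoc)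
    finally show ?thesis using F(2)[OF l(1) neg[OF l(3)]] by simp
  qed
  define avoided where "avoided w G \<longleftrightarrow> (\<exists>\<epsilon>>0. \<forall>y\<in>\<Lambda>. \<forall>f\<in>G. \<epsilon> \<le> dist (y \<cdot> f) w)" for w G
  have "\<exists>is js G. sorted_wrt (<) is \<and> sorted_wrt (<) js \<and> length is = t \<and> length js = t
      \<and> G \<subseteq> F \<and> card G = t \<and> avoided (p is \<cdot> - p js) G" if "t \<le> m" for t
    using that
  proof (induction t)
    case 0
    show ?case
      by (intro exI[of _ "[]"] exI[of _ "{}"]) (auto simp: avoided_def intro: exI[of _ 1])
  next
    case (Suc t)
    then obtain "is" js G where IH: "sorted_wrt (<) is" "sorted_wrt (<) js" "length is = t"
      "length js = t" "G \<subseteq> F" "card G = t" "avoided (p is \<cdot> - p js) G" by auto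
    define w where "w = p is \<cdot> - p js"
    obtain \<epsilon> where \<epsilon>: "\<epsilon> > 0" "\<And>y f. y \<in> \<Lambda> \<Longrightarrow> f \<in> G \<Longrightarrow> \<epsilon> \<le> dist (y \<cdot> f) w"
      using IH(7) unfolding avoided_def w_def by blast
    obtain l f where lf: "l \<in> \<Lambda>" "f \<in> F" "w = l \<cdot> f"
      using quot[OF IH(1,2)] IH(3,4) Suc.prems unfolding w_def by auto
    have "f \<notin> G" using \<epsilon>(1) \<epsilon>(2)[of l f] lf by auto
    obtain \<delta> where \<delta>: "\<delta> > 0" "\<And>y. y \<in> \<Lambda> \<Longrightarrow> y \<cdot> f \<noteq> w \<Longrightarrow> \<delta> \<le> dist (y \<cdot> f) w"
      using translate_discrete[OF lf(1), of f] lf(3) unfolding islimpt_approachable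
      by (auto simp: not_less)
    define q where "q n = p is \<cdot> (x (s n) \<cdot> - x (s (Suc n))) \<cdot> - p js" for n
    have xs: "(\<lambda>n. x (s n)) \<longlonglongrightarrow> a" "(\<lambda>n. x (s (Suc n))) \<longlonglongrightarrow> a"
      using LIMSEQ_subseq_LIMSEQ[OF lim s(1)] LIMSEQ_Suc by (auto simp: o_def)
    have "q \<longlonglongrightarrow> p is \<cdot> (a \<cdot> - a) \<cdot> - p js"
      unfolding q_def by (intro tendsto_intros xs)
    then have "q \<longlonglongrightarrow> w" by (simp add: w_def)
    then have "\<forall>\<^sub>F n in sequentially. dist (q n) w < min \<epsilon> \<delta> / 2"
      using \<epsilon>(1) \<delta>(1) by (intro tendstoD) auto
    moreover have "\<forall>\<^sub>F n in sequentially. Max (insert 0 (set is \<union> set js)) < n"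
      by (rule eventually_gt_at_top)
    ultimately obtain n where n: "dist (q n) w < min \<epsilon> \<delta> / 2"
      "Max (insert 0 (set is \<union> set js)) < n"
      using eventually_happens'[OF sequentially_bot eventually_conj] by blast
    have above: "i < n" if "i \<in> set is \<union> set js" for i
      using n(2) that by (subst (asm) Max_less_iff) auto
    have "x (s n) \<noteq> x (s (Suc n))"
      using x(2) s(1) by (simp add: inj_eq strict_mono_eq)
    have "q n \<noteq> w"
    proof
      assume "q n = w"
      then have "x (s n) \<cdot> - x (s (Suc n)) = 0"
        unfolding q_def w_def by (metis mul_left_cancel mul_right_cancel mul_zero(2))
      then have "x (s n) \<cdot> - x (s (Suc n)) = x (s (Suc n)) \<cdot> - x (s (Suc n))" by simp
      then show False using \<open>x (s n) \<noteq> x (s (Suc n))\<close> unfolding mul_right_cancel by simp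
    qed
    have qn: "p (is @ [n]) \<cdot> - p (js @ [Suc n]) = q n"
      by (simp add: p_def q_def neg_mul mul_assoc)
    define \<eta> where "\<eta> = min (min \<epsilon> \<delta> / 2) (dist (q n) w)"
    have "\<eta> > 0" using \<epsilon>(1) \<delta>(1) \<open>q n \<noteq> w\<close> by (simp add: \<eta>_def)
    have "\<eta> \<le> dist (y \<cdot> f') (q n)" if y: "y \<in> \<Lambda>" "f' \<in> insert f G" for y f'
    proof (cases "f' = f")
      case True
      show ?thesis
      proof (cases "y \<cdot> f = w")
        case False
        then have "\<delta> \<le> dist (y \<cdot> f) w" using \<delta>(2)[OF y(1)] by simp
        then show ?thesis
          using n(1) dist_triangle[of "y \<cdot> f" w "q n"] by (simp add: True \<eta>_def min_def split: if_splits)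
      qed (simp add: True \<eta>_def dist_commute)
    next
      case False
      then have "\<epsilon> \<le> dist (y \<cdot> f') w" using \<epsilon>(2) y by blast
      then show ?thesis
        using n(1) dist_triangle[of "y \<cdot> f'" w "q n"] by (simp add: \<eta>_def min_def split: if_splits)
    qed
    then have "avoided (q n) (insert f G)" unfolding avoided_def using \<open>\<eta> > 0\<close> by blast
    moreover have "card (insert f G) = Suc t"
      using \<open>f \<notin> G\<close> IH(5,6) F(1) by (simp add: finite_subset)
    moreover have "sorted_wrt (<) (is @ [n])" "sorted_wrt (<) (js @ [Suc n])"
      using IH(1,2) above by (auto simp: sorted_wrt_append less_Suc_eq)
    ultimately show ?case
      using IH(3-5) lf(2)
      by (intro exI[of _ "is @ [n]"] exI[of _ "js @ [Suc n]"] exI[of _ "insert f G"]) (simp add: qn)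
  qed
  from this[of m] obtain "is" js G where fin: "sorted_wrt (<) is" "sorted_wrt (<) js"
    "length is = m" "length js = m" "G \<subseteq> F" "card G = m" "avoided (p is \<cdot> - p js) G" by auto
  have "G = F" using fin(5,6) F(1) m_def by (metis card_subset_eq)
  moreover obtain l f where "l \<in> \<Lambda>" "f \<in> F" "p is \<cdot> - p js = l \<cdot> f"
    using quot[OF fin(1,2)] fin(3,4) by auto
  ultimately show False using fin(7) unfolding avoided_def by force
qed

theorem locally_finite:
  assumes "bounded K"
  shows "finite (\<Lambda> \<inter> K)"
proof (rule ccontr)
  assume "infinite (\<Lambda> \<inter> K)"
  then obtain x :: "nat \<Rightarrow> _" where x: "inj x" "range x \<subseteq> \<Lambda> \<inter> K"
    using infinite_countable_subset by blast
  have "bounded (range x)" using assms x(2) bounded_subset by blast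
  then obtain a r where r: "strict_mono r" "(x \<circ> r) \<longlonglongrightarrow> a"
    using bounded_imp_convergent_subsequence by blast
  have "inj (x \<circ> r)" using x(1) strict_mono_imp_inj_on[OF r(1)] by (simp add: inj_compose)
  then show False using no_convergent_sequence[of "x \<circ> r" a] x(2) r(2) by fastforce
qed

lemma products_locally_finite:
  assumes "bounded K"
  shows "finite {g \<in> K. \<exists>xs. length xs = k \<and> set xs \<subseteq> \<Lambda> \<and> g = list_mul xs}"
proof -
  obtain F where F: "finite F"
    "\<forall>xs. length xs = k \<and> set xs \<subseteq> \<Lambda> \<longrightarrow> (\<exists>l\<in>\<Lambda>. \<exists>f\<in>F. list_mul xs = l \<cdot> f)"
    using list_mul_cover[of k] by blast
  define C where "C = (\<lambda>(x, y). x \<cdot> y) ` (K \<times> uminus ` F)"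
  have "bounded C" unfolding C_def
    by (intro bounded_mul[OF assms] finite_imp_bounded finite_imageI F(1))
  have "g \<in> (\<lambda>(l, f). l \<cdot> f) ` ((\<Lambda> \<inter> C) \<times> F)" if "g \<in> K" "g = l \<cdot> f" "l \<in> \<Lambda>" "f \<in> F" for g l f
  proof -
    have "l = g \<cdot> - f" using that(2) by (simp add: mul_assoc)
    then have "l \<in> C" unfolding C_def using that by force
    then show ?thesis using that by auto
  qed
  then have "{g \<in> K. \<exists>xs. length xs = k \<and> set xs \<subseteq> \<Lambda> \<and> g = list_mul xs}
    \<subseteq> (\<lambda>(l, f). l \<cdot> f) ` ((\<Lambda> \<inter> C) \<times> F)"
    using F(2) by blast
  then show ?thesis
    using locally_finite[OF \<open>bounded C\<close>] F(1) by (meson finite_SigmaI finite_imageI finite_subset)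
qed

end

section \<open>The subgroup close to a discrete approximate subgroup\<close>


text \<open>Rescaling a point where \<open>f\<close> does not vanish makes the values of \<open>f\<close> unbounded.\<close>

lemma linear_bounded_on_subspace_eq_0:
  fixes f :: "'a::real_vector \<Rightarrow> real"
  assumes "linear f" "subspace S" and bound: "\<And>x. x \<in> S \<Longrightarrow> \<bar>f x\<bar> \<le> C" and "x \<in> S"
  shows "f x = 0"
proof (rule ccontr)
  assume nz: "f x \<noteq> 0"
  define s where "s = (\<bar>C\<bar> + 1) / f x"
  have "f (s *\<^sub>R x) = \<bar>C\<bar> + 1"
    using linear_scale[OF \<open>linear f\<close>, of s x] nz by (simp add: s_def)
  moreover have "s *\<^sub>R x \<in> S" using assms(2,4) by (simp add: subspace_scale)
  ultimately show False using bound by fastforce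
qed

context heisenberg_space
begin

lemma linear_\<omega>: "linear (\<lambda>v. \<omega> v w)" "linear (\<omega> w)"
  by (rule linearI; simp add: \<omega>_simps)+

lemma commutator: "x \<cdot> (y \<cdot> (- x \<cdot> - y)) = (0, \<omega> (fst x) (fst y))"
  using antisymmetric[of "fst y" "fst x"] by (simp add: mul_def \<omega>_simps alternating)

lemma mul_central: "x \<cdot> (0, c) = x + (0, c)"
  by (simp add: mul_def \<omega>_simps prod_eq_iff)

lemma neg_mul_eq_diff: "\<omega> (fst h) (fst x) = 0 \<Longrightarrow> - h \<cdot> x = x - h"
  by (simp add: mul_def \<omega>_simps prod_eq_iff)

end

lemma norm_le_fst_snd: "norm x \<le> norm (fst x) + norm (snd x)"
  using norm_Pair_le[of "fst x" "snd x"] by simp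

text \<open>Here \<open>- h\<close> is the inverse of \<open>h\<close>, so that for any left-invariant metric \<open>- h \<cdot> x\<close> is as far from
  the identity as \<open>h\<close> is from \<open>x\<close>. Working with bounded sets of coordinates avoids the metric, whose
  balls may be much larger.\<close>

definition (in heisenberg_space) coarsely_dense_around :: "('v \<times> real) set \<Rightarrow> ('v \<times> real) set \<Rightarrow> bool"
  where "coarsely_dense_around A H \<longleftrightarrow>
    (\<exists>K. bounded K \<and> (\<forall>h\<in>H. \<exists>x\<in>A. - h \<cdot> x \<in> K) \<and> (\<forall>x\<in>A. \<exists>h\<in>H. - h \<cdot> x \<in> K))"

context discrete_approximate_subgroup
begin

lemma projection_near_subspace:
  "\<exists>L R. subspace L \<and> (\<forall>x\<in>\<Lambda>. \<exists>l\<in>L. norm (fst x - l) \<le> R) \<and> (\<forall>l\<in>L. \<exists>x\<in>\<Lambda>. norm (l - fst x) \<le> R)"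
proof -
  obtain F where F: "finite F" "\<forall>x\<in>\<Lambda>. \<forall>y\<in>\<Lambda>. \<exists>l\<in>\<Lambda>. \<exists>f\<in>F. x \<cdot> y = l \<cdot> f"
    using cover by blast
  obtain r where r: "\<forall>f\<in>F. norm f \<le> r"
    using finite_imp_bounded[OF F(1)] bounded_iff by blast
  have add: "\<exists>c\<in>fst ` \<Lambda>. norm (a + b - c) \<le> r" if "a \<in> fst ` \<Lambda>" "b \<in> fst ` \<Lambda>" for a b
  proof -
    obtain x y where xy: "x \<in> \<Lambda>" "y \<in> \<Lambda>" "a = fst x" "b = fst y" using \<open>a \<in> _\<close> \<open>b \<in> _\<close> by blast
    obtain l f where lf: "l \<in> \<Lambda>" "f \<in> F" "x \<cdot> y = l \<cdot> f" using F(2) xy(1,2) by blast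
    have "a + b - fst l = fst f" using arg_cong[OF lf(3), of fst] by (simp add: xy)
    moreover have "norm (fst f) \<le> r" using r lf(2) norm_fst_le[of "fst f" "snd f"] by force
    ultimately show ?thesis using lf(1) by (intro bexI[of _ "fst l"]) auto
  qed
  have "0 \<in> fst ` \<Lambda>" using zero by force
  moreover have "- a \<in> fst ` \<Lambda>" if "a \<in> fst ` \<Lambda>" for a using that neg by force
  ultimately obtain L R where "subspace L" "\<And>a. a \<in> fst ` \<Lambda> \<Longrightarrow> \<exists>l\<in>L. norm (a - l) \<le> R"
    "\<And>l. l \<in> L \<Longrightarrow> \<exists>a\<in>fst ` \<Lambda>. norm (l - a) \<le> R"
    using approximate_subgroup_near_subspace[OF _ _ add] by metis
  then show ?thesis by (intro exI[of _ L] exI[of _ R]) auto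
qed

text \<open>The commutator of \<open>x\<close> and \<open>y\<close> is \<open>(0, \<omega> (\<pi> x) (\<pi> y))\<close>. As \<open>\<pi> x\<close> follows the line through
  \<open>l\<^sub>0\<close> up to a bounded error, this number follows every real up to a bounded error.\<close>

lemma central_products:
  assumes "subspace L" and L: "\<forall>l\<in>L. \<exists>x\<in>\<Lambda>. norm (l - fst x) \<le> R"
    and l0: "l\<^sub>0 \<in> L" "y \<in> \<Lambda>" "\<omega> l\<^sub>0 (fst y) \<noteq> 0"
  shows "\<exists>C\<ge>0. \<forall>t. \<exists>c xs. \<bar>t - c\<bar> \<le> C \<and> length xs = 4 \<and> set xs \<subseteq> \<Lambda> \<and> list_mul xs = (0, c)"
proof -
  obtain M where M: "M > 0" "\<And>a b. norm (\<omega> a b) \<le> norm a * norm b * M"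
    using bounded_bilinear.pos_bounded[OF bilinear] by blast
  have "R \<ge> 0" using L subspace_0[OF \<open>subspace L\<close>] norm_ge_zero order_trans by blast
  have "\<exists>c xs. \<bar>t - c\<bar> \<le> R * norm (fst y) * M \<and> length xs = 4 \<and> set xs \<subseteq> \<Lambda> \<and> list_mul xs = (0, c)" for t
  proof -
    define l where "l = (t / \<omega> l\<^sub>0 (fst y)) *\<^sub>R l\<^sub>0"
    have "l \<in> L" unfolding l_def using \<open>subspace L\<close> l0(1) by (rule subspace_scale)
    then obtain x where x: "x \<in> \<Lambda>" "norm (l - fst x) \<le> R" using L by blast
    have "t - \<omega> (fst x) (fst y) = \<omega> (l - fst x) (fst y)"
      using l0(3) by (simp add: l_def \<omega>_simps)
    also have "\<bar>\<dots>\<bar> \<le> norm (l - fst x) * norm (fst y) * M" using M(2) by simp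
    also have "\<dots> \<le> R * norm (fst y) * M" using x(2) M(1) by (intro mult_right_mono) auto
    finally have "\<bar>t - \<omega> (fst x) (fst y)\<bar> \<le> R * norm (fst y) * M" .
    moreover have "list_mul [x, y, - x, - y] = (0, \<omega> (fst x) (fst y))" by (simp add: commutator)
    ultimately show ?thesis using x(1) l0(2) neg
      by (intro exI[of _ "\<omega> (fst x) (fst y)"] exI[of _ "[x, y, - x, - y]"]) auto
  qed
  then show ?thesis using \<open>R \<ge> 0\<close> M(1) by (intro exI[of _ "R * norm (fst y) * M"]) auto
qed

text \<open>A given \<open>h \<in> L \<times> \<real>\<close> is approached in two steps: an element of \<open>\<Lambda>\<close> matches the component in \<open>V\<close>,
  then a central product of four elements repairs the last coordinate without disturbing the first.
  The result is a product of five elements, hence an element of \<open>\<Lambda>\<close> up to a finite error. The same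
  repair moves every element of \<open>\<Lambda>\<close> with bounded projection to a bounded product of five elements
  with the same projection, and there are only finitely many of those.\<close>

lemma central_case:
  assumes "subspace L" and near: "\<forall>x\<in>\<Lambda>. \<exists>l\<in>L. norm (fst x - l) \<le> R"
    and L: "\<forall>l\<in>L. \<exists>x\<in>\<Lambda>. norm (l - fst x) \<le> R"
    and l0: "l\<^sub>0 \<in> L" "y \<in> \<Lambda>" "\<omega> l\<^sub>0 (fst y) \<noteq> 0"
  shows "coarsely_dense_around \<Lambda> (L \<times> UNIV)" (is ?dense)
    and "bounded B \<Longrightarrow> finite (fst ` \<Lambda> \<inter> B)"
proof -
  obtain C where C: "C \<ge> 0"
    "\<And>t. \<exists>c xs. \<bar>t - c\<bar> \<le> C \<and> length xs = 4 \<and> set xs \<subseteq> \<Lambda> \<and> list_mul xs = (0, c)"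
    using central_products[OF \<open>subspace L\<close> L l0] by blast
  have move: "\<exists>c xs. \<bar>t - (snd x + c)\<bar> \<le> C \<and> length xs = 5 \<and> set xs \<subseteq> \<Lambda> \<and> list_mul xs = x + (0, c)"
    if x: "x \<in> \<Lambda>" for x t
  proof -
    obtain c xs where "\<bar>(t - snd x) - c\<bar> \<le> C" "length xs = 4" "set xs \<subseteq> \<Lambda>" "list_mul xs = (0, c)"
      using C(2) by blast
    then show ?thesis
      using x by (intro exI[of _ c] exI[of _ "x # xs"]) (auto simp: mul_central algebra_simps)
  qed
  show ?dense
  proof -
    obtain F where F: "finite F"
      "\<forall>xs. length xs = 5 \<and> set xs \<subseteq> \<Lambda> \<longrightarrow> (\<exists>l\<in>\<Lambda>. \<exists>f\<in>F. list_mul xs = l \<cdot> f)"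
      using list_mul_cover[of 5] by blast
    define K0 :: "('v \<times> real) set" where "K0 = cball 0 (R + C)"
    define K where "K = K0 \<union> (\<lambda>(x, y). x \<cdot> y) ` (K0 \<times> uminus ` F)"
    have "bounded K"
      unfolding K_def K0_def
      by (intro bounded_Un[THEN iffD2] conjI bounded_mul bounded_cball finite_imp_bounded finite_imageI F(1))
    have "\<exists>x\<in>\<Lambda>. - h \<cdot> x \<in> K" if h: "h \<in> L \<times> UNIV" for h
    proof -
      obtain x where x: "x \<in> \<Lambda>" "norm (fst h - fst x) \<le> R" using L h by (auto simp: mem_Times_iff)
      obtain c xs where c: "\<bar>(snd h + \<omega> (fst h) (fst x) / 2) - (snd x + c)\<bar> \<le> C"
        and xs: "length xs = 5" "set xs \<subseteq> \<Lambda>" "list_mul xs = x + (0, c)"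
        using move[OF x(1)] by blast
      obtain l f where lf: "l \<in> \<Lambda>" "f \<in> F" "x + (0, c) = l \<cdot> f" using F(2) xs by metis
      have "- h \<cdot> (x + (0, c)) = (fst x - fst h, (snd x + c) - (snd h + \<omega> (fst h) (fst x) / 2))"
        by (simp add: mul_def \<omega>_simps)
      also have "norm \<dots> \<le> norm (fst x - fst h) + norm ((snd x + c) - (snd h + \<omega> (fst h) (fst x) / 2))"
        by (rule norm_Pair_le)
      also have "\<dots> \<le> R + C" using x(2) c by (simp add: norm_minus_commute abs_minus_commute)
      finally have "- h \<cdot> (x + (0, c)) \<in> K0" by (simp add: K0_def)
      moreover have "- h \<cdot> l = - h \<cdot> (x + (0, c)) \<cdot> - f" by (simp add: lf(3) mul_assoc)
      ultimately have "- h \<cdot> l \<in> K" unfolding K_def using lf(2) by force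
      then show ?thesis using lf(1) by blast
    qed
    moreover have "\<exists>h\<in>L \<times> UNIV. - h \<cdot> x \<in> K" if "x \<in> \<Lambda>" for x
    proof -
      obtain l where l: "l \<in> L" "norm (fst x - l) \<le> R" using near \<open>x \<in> \<Lambda>\<close> by blast
      have "- (l, snd x - \<omega> l (fst x) / 2) \<cdot> x = (fst x - l, 0)" by (simp add: mul_def \<omega>_simps)
      also have "\<dots> \<in> K" using l(2) C(1) by (simp add: K_def K0_def norm_Pair)
      finally show ?thesis using l(1) by blast
    qed
    ultimately show ?thesis unfolding coarsely_dense_around_def using \<open>bounded K\<close> by blast
  qed
  show "finite (fst ` \<Lambda> \<inter> B)" if "bounded B"
  proof -
    define P where "P = {g \<in> B \<times> cball 0 C. \<exists>xs. length xs = 5 \<and> set xs \<subseteq> \<Lambda> \<and> g = list_mul xs}"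
    have "finite P"
      unfolding P_def by (intro products_locally_finite bounded_Times \<open>bounded B\<close> bounded_cball)
    moreover have "fst ` \<Lambda> \<inter> B \<subseteq> fst ` P"
    proof
      fix b assume "b \<in> fst ` \<Lambda> \<inter> B"
      then obtain x where x: "x \<in> \<Lambda>" "b = fst x" "b \<in> B" by blast
      obtain c xs where c: "\<bar>0 - (snd x + c)\<bar> \<le> C"
        and xs: "length xs = 5" "set xs \<subseteq> \<Lambda>" "list_mul xs = x + (0, c)"
        using move[OF x(1)] by blast
      have "list_mul xs \<in> P"
        unfolding P_def using c xs(1,2) x by (auto simp: xs(3) mem_Times_iff)
      moreover have "fst (list_mul xs) = b" by (simp add: xs(3) x(2))
      ultimately show "b \<in> fst ` P" by blast
    qed
    ultimately show ?thesis by (meson finite_imageI finite_subset)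
  qed
qed

text \<open>Since \<open>\<omega>\<close> vanishes between \<open>L\<close> and \<open>\<pi>(\<Lambda>)\<close>, and hence on \<open>L\<close>, its values on \<open>\<pi>(\<Lambda>)\<close> depend
  only on the bounded deviations from \<open>L\<close>. So group product and vector sum of elements of \<open>\<Lambda>\<close> differ
  by a bounded amount, and \<open>\<Lambda>\<close> is an approximate subgroup of the vector space \<open>V \<times> \<real>\<close>. For the
  subspace \<open>H\<close> close to it, \<open>\<omega>\<close> between \<open>\<pi>(H)\<close> and \<open>\<pi>(\<Lambda>)\<close>, and then on \<open>\<pi>(H)\<close>, is linear and
  bounded, hence zero. Therefore the group structure on \<open>H\<close> is addition, and Euclidean distances
  between \<open>H\<close> and \<open>\<Lambda>\<close> agree with the size of the quotients.\<close>

lemma isotropic_case: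
  assumes "infinite \<Lambda>" "subspace L" and near: "\<forall>x\<in>\<Lambda>. \<exists>l\<in>L. norm (fst x - l) \<le> R"
    and L: "\<forall>l\<in>L. \<exists>x\<in>\<Lambda>. norm (l - fst x) \<le> R"
    and orth: "\<And>l x. l \<in> L \<Longrightarrow> x \<in> \<Lambda> \<Longrightarrow> \<omega> l (fst x) = 0"
  shows "\<exists>H. subspace H \<and> H \<noteq> {0} \<and> (\<forall>h\<in>H. \<forall>k\<in>H. \<omega> (fst h) (fst k) = 0)
    \<and> coarsely_dense_around \<Lambda> H"
proof -
  obtain M where M: "M > 0" "\<And>a b. norm (\<omega> a b) \<le> norm a * norm b * M"
    using bounded_bilinear.pos_bounded[OF bilinear] by blast
  have M': "\<bar>\<omega> a b\<bar> \<le> r * s * M" if "norm a \<le> r" "norm b \<le> s" for a b r s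
  proof -
    have "r \<ge> 0" using \<open>norm a \<le> r\<close> norm_ge_zero order_trans by blast
    then have "norm a * norm b * M \<le> r * s * M"
      using M(1) \<open>norm a \<le> r\<close> \<open>norm b \<le> s\<close> by (intro mult_right_mono mult_mono) auto
    then show ?thesis using M(2)[of a b] by simp
  qed
  have isotropic: "\<omega> k l = 0" if "k \<in> L" "l \<in> L" for k l
  proof (rule linear_bounded_on_subspace_eq_0[OF linear_\<omega>(2) \<open>subspace L\<close> _ \<open>l \<in> L\<close>])
    fix l assume "l \<in> L"
    then obtain x where x: "x \<in> \<Lambda>" "norm (l - fst x) \<le> R" using L by blast
    have "\<omega> k l = \<omega> k (l - fst x)" using orth[OF \<open>k \<in> L\<close> x(1)] by (simp add: \<omega>_simps)
    then show "\<bar>\<omega> k l\<bar> \<le> norm k * R * M" using M'[OF order_refl x(2)] by simp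
  qed
  define D where "D = R * R * M"
  have D: "\<bar>\<omega> (fst x) (fst y)\<bar> \<le> D" if "x \<in> \<Lambda>" "y \<in> \<Lambda>" for x y
  proof -
    obtain k where k: "k \<in> L" "norm (fst x - k) \<le> R" using near \<open>x \<in> \<Lambda>\<close> by blast
    obtain l where l: "l \<in> L" "norm (fst y - l) \<le> R" using near \<open>y \<in> \<Lambda>\<close> by blast
    have "\<omega> (fst x - k) (fst y - l) = \<omega> (fst x) (fst y)"
      using orth[OF k(1) \<open>y \<in> \<Lambda>\<close>] orth[OF l(1) \<open>x \<in> \<Lambda>\<close>] isotropic[OF k(1) l(1)]
        antisymmetric[of "fst x" l] by (simp add: \<omega>_simps)
    then show ?thesis using M'[OF k(2) l(2)] by (simp add: D_def)
  qed
  obtain F where F: "finite F" "\<forall>x\<in>\<Lambda>. \<forall>y\<in>\<Lambda>. \<exists>l\<in>\<Lambda>. \<exists>f\<in>F. x \<cdot> y = l \<cdot> f"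
    using cover by blast
  obtain r where r: "\<forall>f\<in>F. norm f \<le> r"
    using finite_imp_bounded[OF F(1)] bounded_iff by blast
  have add: "\<exists>z\<in>\<Lambda>. norm (x + y - z) \<le> r + r + 2 * D" if xy: "x \<in> \<Lambda>" "y \<in> \<Lambda>" for x y
  proof -
    obtain z f where zf: "z \<in> \<Lambda>" "f \<in> F" "x \<cdot> y = z \<cdot> f" using F(2) xy by blast
    \<comment> \<open>The error \<open>f\<close> is itself built from elements of \<open>\<Lambda>\<close>, which bounds \<open>\<omega> (\<pi> z) (\<pi> f)\<close> although
      \<open>z\<close> is unbounded.\<close>
    have f: "fst f = fst x + fst y - fst z" using arg_cong[OF zf(3), of fst] by simp
    have s: "snd (x + y - z) = snd f + \<omega> (fst z) (fst x) / 2 + \<omega> (fst z) (fst y) / 2 - \<omega> (fst x) (fst y) / 2"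
      using arg_cong[OF zf(3), of snd] by (simp add: mul_def f \<omega>_simps alternating field_simps)
    have "norm (snd f) \<le> r" "norm (fst f) \<le> r"
      using r zf(2) norm_fst_le[of "fst f" "snd f"] norm_snd_le[of "snd f" "fst f"] by force+
    moreover have "norm (x + y - z) \<le> norm (fst f) + norm (snd (x + y - z))"
      using norm_le_fst_snd[of "x + y - z"] by (simp add: f)
    ultimately have "norm (x + y - z) \<le> r + r + 2 * D"
      using D[OF zf(1) xy(1)] D[OF zf(1) xy(2)] D[OF xy] unfolding s real_norm_def by linarith
    then show ?thesis using zf(1) by blast
  qed
  obtain H S where "subspace H" and near_H: "\<And>x. x \<in> \<Lambda> \<Longrightarrow> \<exists>h\<in>H. norm (x - h) \<le> S"
    and H: "\<And>h. h \<in> H \<Longrightarrow> \<exists>x\<in>\<Lambda>. norm (h - x) \<le> S"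
    using approximate_subgroup_near_subspace[OF zero neg add] by blast
  have fst_H: "norm (fst h - fst x) \<le> S" if "norm (h - x) \<le> S" for h x :: "'v \<times> real"
  proof -
    have "norm (fst (h - x)) \<le> norm (h - x)" by (metis norm_fst_le prod.collapse)
    then show ?thesis using that by simp
  qed
  have orth_H: "\<omega> (fst h) (fst y) = 0" if "h \<in> H" "y \<in> \<Lambda>" for h y
  proof (rule linear_bounded_on_subspace_eq_0[OF _ \<open>subspace H\<close> _ \<open>h \<in> H\<close>])
    show "linear (\<lambda>h. \<omega> (fst h) (fst y))" by (rule linearI) (simp_all add: \<omega>_simps)
    fix h assume "h \<in> H"
    then obtain x where x: "x \<in> \<Lambda>" "norm (h - x) \<le> S" using H by blast
    have "\<omega> (fst h) (fst y) = \<omega> (fst x) (fst y) + \<omega> (fst h - fst x) (fst y)" by (simp add: \<omega>_simps)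
    then show "\<bar>\<omega> (fst h) (fst y)\<bar> \<le> D + S * norm (fst y) * M"
      using D[OF x(1) \<open>y \<in> \<Lambda>\<close>] M'[OF fst_H[OF x(2)] order_refl, of "fst y"] by linarith
  qed
  have "\<omega> (fst h) (fst k) = 0" if "h \<in> H" "k \<in> H" for h k
  proof (rule linear_bounded_on_subspace_eq_0[OF _ \<open>subspace H\<close> _ \<open>k \<in> H\<close>])
    show "linear (\<lambda>k. \<omega> (fst h) (fst k))" by (rule linearI) (simp_all add: \<omega>_simps)
    fix k assume "k \<in> H"
    then obtain x where x: "x \<in> \<Lambda>" "norm (k - x) \<le> S" using H by blast
    have "\<omega> (fst h) (fst k) = \<omega> (fst h) (fst k - fst x)"
      using orth_H[OF \<open>h \<in> H\<close> x(1)] by (simp add: \<omega>_simps)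
    then show "\<bar>\<omega> (fst h) (fst k)\<bar> \<le> norm (fst h) * S * M"
      using M'[OF order_refl fst_H[OF x(2)]] by simp
  qed
  moreover have "coarsely_dense_around \<Lambda> H"
    unfolding coarsely_dense_around_def
  proof (intro exI[of _ "cball 0 S"] conjI ballI bounded_cball)
    have diff: "- h \<cdot> x \<in> cball 0 S" if "h \<in> H" "x \<in> \<Lambda>" "norm (h - x) \<le> S" for h x
      using neg_mul_eq_diff[OF orth_H[OF that(1,2)]] that(3) by (simp add: norm_minus_commute)
    show "\<exists>x\<in>\<Lambda>. - h \<cdot> x \<in> cball 0 S" if "h \<in> H" for h using H diff that by blast
    show "\<exists>h\<in>H. - h \<cdot> x \<in> cball 0 S" if "x \<in> \<Lambda>" for x
      using near_H diff that by (metis norm_minus_commute)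
  qed
  moreover have "H \<noteq> {0}"
  proof
    assume "H = {0}"
    then have "\<Lambda> \<inter> cball 0 S = \<Lambda>" using near_H by force
    then show False using locally_finite[of "cball 0 S"] \<open>infinite \<Lambda>\<close> by simp
  qed
  ultimately show ?thesis using \<open>subspace H\<close> by blast
qed

theorem coarse_structure:
  assumes "infinite \<Lambda>"
  shows "\<exists>H. subspace H \<and> H \<noteq> {0} \<and> (\<forall>h\<in>H. \<forall>k\<in>H. h \<cdot> k \<in> H) \<and> coarsely_dense_around \<Lambda> H
    \<and> ((\<forall>h\<in>H. \<forall>k\<in>H. h \<cdot> k = k \<cdot> h) \<or> (\<forall>B. bounded B \<longrightarrow> finite (fst ` \<Lambda> \<inter> B)))"
proof -
  obtain L R where L: "subspace L" "\<forall>x\<in>\<Lambda>. \<exists>l\<in>L. norm (fst x - l) \<le> R"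
    "\<forall>l\<in>L. \<exists>x\<in>\<Lambda>. norm (l - fst x) \<le> R"
    using projection_near_subspace by blast
  show ?thesis
  proof (cases "\<exists>l\<in>L. \<exists>y\<in>\<Lambda>. \<omega> l (fst y) \<noteq> 0")
    case True
    then obtain l y where ly: "l \<in> L" "y \<in> \<Lambda>" "\<omega> l (fst y) \<noteq> 0" by blast
    have "subspace (L \<times> (UNIV :: real set))" by (intro subspace_Times L(1) subspace_UNIV)
    moreover have "(0, 1) \<in> L \<times> (UNIV :: real set)" using subspace_0[OF L(1)] by simp
    then have "L \<times> (UNIV :: real set) \<noteq> {0}" by (auto simp: zero_prod_def)
    moreover have "\<forall>h\<in>L \<times> UNIV. \<forall>k\<in>L \<times> UNIV. h \<cdot> k \<in> L \<times> UNIV"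
      using subspace_add[OF L(1)] by (auto simp: mem_Times_iff)
    ultimately show ?thesis
      using central_case[OF L ly] by blast
  next
    case False
    then obtain H where H: "subspace H" "H \<noteq> {0}" "\<forall>h\<in>H. \<forall>k\<in>H. \<omega> (fst h) (fst k) = 0"
      "coarsely_dense_around \<Lambda> H"
      using isotropic_case[OF assms L] by blast
    have "h \<cdot> k = h + k" if "h \<in> H" "k \<in> H" for h k
      using H(3) that by (simp add: mul_def prod_eq_iff)
    then show ?thesis
      using H subspace_add[OF H(1)] by (intro exI[of _ H]) (simp add: add.commute)
  qed
qed

end

section \<open>Left-invariant metrics\<close>

lemma symplectic_form_imp_heisenberg_space:
  fixes \<omega> :: "'v::euclidean_space \<Rightarrow> 'v \<Rightarrow> real"
  assumes "symplectic_form \<omega>"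
  shows "heisenberg_space \<omega>"
proof (rule heisenberg_space.intro)
  show "bounded_bilinear \<omega>"
    using assms by (simp add: symplectic_form_def bilinear_conv_bounded_bilinear)
  have "\<omega> v v = - \<omega> v v" for v using assms unfolding symplectic_form_def by blast
  then show "\<omega> v v = 0" for v by (metis equal_neg_zero)
qed

context heisenberg_space
begin

lemma heisenberg_mult_eq: "x \<otimes>\<^bsub>heisenberg \<omega>\<^esub> y = x \<cdot> y"
  by (cases x; cases y) (simp add: mul_def)

lemma heisenberg_group: "group (heisenberg \<omega>)"
proof (rule groupI)
  show "\<exists>y\<in>carrier (heisenberg \<omega>). y \<otimes>\<^bsub>heisenberg \<omega>\<^esub> x = \<one>\<^bsub>heisenberg \<omega>\<^esub>" for x
    by (intro bexI[of _ "- x"]) (simp_all add: heisenberg_mult_eq flip: zero_prod_def)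
qed (simp_all add: heisenberg_mult_eq mul_assoc flip: zero_prod_def)

lemma heisenberg_inv_eq: "inv\<^bsub>heisenberg \<omega>\<^esub> x = - x"
  by (rule group.inv_equality[OF heisenberg_group])
    (simp_all add: heisenberg_mult_eq flip: zero_prod_def)

context
  fixes d :: "'v \<times> real \<Rightarrow> 'v \<times> real \<Rightarrow> real"
  assumes d: "heisenberg_metric \<omega> d"
begin

interpretation Metric_space UNIV d
  using d by (simp add: heisenberg_metric_def)

lemma left_invariant: "d h x = d 0 (- h \<cdot> x)"
proof -
  have "d (- h \<cdot> h) (- h \<cdot> x) = d h x"
    using d unfolding heisenberg_metric_def heisenberg_mult_eq by blast
  then show ?thesis by simp
qed

lemma tendsto_iff_metric: "s \<longlonglongrightarrow> l \<longleftrightarrow> (\<lambda>k. d (s k) l) \<longlonglongrightarrow> 0"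
proof -
  have "\<forall>v z v' z'. limitin mtopology (\<lambda>k::nat. (v k, z k)) (v', z') sequentially
      \<longleftrightarrow> v \<longlonglongrightarrow> v' \<and> z \<longlonglongrightarrow> z'"
    using d by (simp add: heisenberg_metric_def)
  from this[rule_format, of "\<lambda>k. fst (s k)" "\<lambda>k. snd (s k)" "fst l" "snd l"]
  have "limitin mtopology s l sequentially
      \<longleftrightarrow> (\<lambda>k. fst (s k)) \<longlonglongrightarrow> fst l \<and> (\<lambda>k. snd (s k)) \<longlonglongrightarrow> snd l"
    by simp
  moreover have "(\<lambda>k. fst (s k)) \<longlonglongrightarrow> fst l \<and> (\<lambda>k. snd (s k)) \<longlonglongrightarrow> snd l \<longleftrightarrow> s \<longlonglongrightarrow> l"
    using tendsto_Pair[of "\<lambda>k. fst (s k)" "fst l" sequentially "\<lambda>k. snd (s k)" "snd l"]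
    by (auto intro: tendsto_fst tendsto_snd)
  ultimately show ?thesis by (simp add: limitin_metric_dist_null)
qed

lemma discrete_wrt_not_islimpt:
  assumes "discrete_wrt d A" "l \<in> A"
  shows "\<not> l islimpt A"
proof
  assume "l islimpt A"
  then obtain s where s: "\<forall>n. s n \<in> A - {l}" "s \<longlonglongrightarrow> l" unfolding islimpt_sequential by blast
  obtain \<delta> where \<delta>: "\<delta> > 0" "mcball l \<delta> \<inter> A = {l}"
    using assms unfolding discrete_wrt_def by blast
  have "\<forall>\<^sub>F n in sequentially. d (s n) l < \<delta>"
    using s(2) \<delta>(1) unfolding tendsto_iff_metric by (rule order_tendstoD)
  then obtain n where "d (s n) l < \<delta>" using eventually_happens'[OF sequentially_bot] by blast
  then have "s n \<in> mcball l \<delta> \<inter> A" using s(1) by (auto simp: commute)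
  then show False using \<delta>(2) s(1) by blast
qed

text \<open>Bounded sets of coordinates are relatively compact, and the metric is continuous for the
  coordinate topology. The converse fails for metrics that are not proper.\<close>

lemma bounded_imp_metric_bounded:
  assumes "bounded K"
  shows "\<exists>R>0. \<forall>g\<in>K. d 0 g \<le> R"
proof (rule ccontr)
  assume unbounded: "\<not> ?thesis"
  have "\<forall>n. \<exists>g. g \<in> K \<and> real (Suc n) < d 0 g"
  proof
    fix n
    have "real (Suc n) > 0" by simp
    then show "\<exists>g. g \<in> K \<and> real (Suc n) < d 0 g" using unbounded not_le by blast
  qed
  from choice[OF this] obtain s where s: "\<forall>n. s n \<in> K \<and> real (Suc n) < d 0 (s n)" ..
  have "bounded (range s)" using s by (intro bounded_subset[OF assms]) auto
  then obtain a r where r: "strict_mono r" "(s \<circ> r) \<longlonglongrightarrow> a"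
    using bounded_imp_convergent_subsequence by blast
  have "\<forall>\<^sub>F n in sequentially. d ((s \<circ> r) n) a < 1"
    using r(2) unfolding tendsto_iff_metric by (rule order_tendstoD) simp
  moreover have "\<forall>\<^sub>F n in sequentially. d 0 a \<le> real n"
    by (rule eventually_sequentiallyI[of "nat \<lceil>d 0 a\<rceil>"]) linarith
  ultimately have "\<forall>\<^sub>F n in sequentially. False"
  proof eventually_elim
    case (elim n)
    have "d 0 (s (r n)) \<le> d 0 a + d a (s (r n))" by (rule triangle) auto
    moreover have "real n \<le> real (r n)" using seq_suble[OF r(1)] by simp
    moreover have "real (Suc (r n)) < d 0 (s (r n))" using s by blast
    ultimately show False using elim by (simp add: commute)
  qed
  then show False by simp
qed

text \<open>A linear subspace is connected in the Euclidean topology, and the identity is continuous from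
  there to the metric topology.\<close>

lemma connectedin_subspace:
  assumes "subspace H"
  shows "connectedin mtopology H"
proof -
  have "open U" if U: "openin mtopology U" for U
    unfolding open_closed closed_sequential_limits
  proof (intro allI impI)
    fix s l assume s: "(\<forall>n. s n \<in> - U) \<and> s \<longlonglongrightarrow> l"
    show "l \<in> - U"
    proof
      assume "l \<in> U"
      then obtain r where r: "r > 0" "mball l r \<subseteq> U" using U unfolding openin_mtopology by blast
      have "\<forall>\<^sub>F n in sequentially. d (s n) l < r"
        using conjunct2[OF s] r(1) unfolding tendsto_iff_metric by (rule order_tendstoD)
      then obtain n where "d (s n) l < r" using eventually_happens'[OF sequentially_bot] by blast
      then have "s n \<in> mball l r" by (simp add: commute)
      then show False using r(2) s by blast
    qed
  qed
  then have "continuous_map euclidean mtopology (\<lambda>x. x)"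
    by (simp add: continuous_map_def)
  moreover have "connectedin euclidean H"
    using assms by (simp add: convex_connected subspace_imp_convex)
  ultimately have "connectedin mtopology ((\<lambda>x. x) ` H)" by (rule connectedin_continuous_map_image)
  then show ?thesis by simp
qed

lemma coarsely_dense_around_imp_relatively_dense_around:
  assumes "coarsely_dense_around A H"
  shows "relatively_dense_around d A H"
proof -
  obtain K where K: "bounded K" "\<forall>h\<in>H. \<exists>x\<in>A. - h \<cdot> x \<in> K" "\<forall>x\<in>A. \<exists>h\<in>H. - h \<cdot> x \<in> K"
    using assms unfolding coarsely_dense_around_def by blast
  obtain R where R: "R > 0" "\<forall>g\<in>K. d 0 g \<le> R" using bounded_imp_metric_bounded[OF K(1)] by blast
  have ball: "x \<in> mcball h R" if "- h \<cdot> x \<in> K" for h x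
    using R(2) that by (simp add: left_invariant[of h x])
  show ?thesis
    unfolding relatively_dense_around_def
  proof (intro exI[of _ R] conjI ballI subsetI R(1))
    show "mcball h R \<inter> A \<noteq> {}" if "h \<in> H" for h using K(2) ball that by blast
    show "x \<in> (\<Union>h\<in>H. mcball h R)" if "x \<in> A" for x using K(3) ball that by blast
  qed
qed

end

lemma approximate_subgroup_neg:
  assumes "approximate_subgroup (heisenberg \<omega>) \<Lambda>" "x \<in> \<Lambda>"
  shows "- x \<in> \<Lambda>"
proof -
  have "- x \<in> set_inv\<^bsub>heisenberg \<omega>\<^esub> \<Lambda>"
    using assms(2) by (auto simp: SET_INV_def heisenberg_inv_eq)
  then show ?thesis using assms(1) by (simp add: approximate_subgroup_def)
qed

text \<open>Taking inverses turns left translates into right translates.\<close>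

lemma approximate_subgroup_cover:
  assumes "approximate_subgroup (heisenberg \<omega>) \<Lambda>"
  shows "\<exists>F. finite F \<and> (\<forall>x\<in>\<Lambda>. \<forall>y\<in>\<Lambda>. \<exists>l\<in>\<Lambda>. \<exists>f\<in>F. x \<cdot> y = l \<cdot> f)"
proof -
  obtain F where F: "finite F" "\<Lambda> <#>\<^bsub>heisenberg \<omega>\<^esub> \<Lambda> \<subseteq> F <#>\<^bsub>heisenberg \<omega>\<^esub> \<Lambda>"
    using assms unfolding approximate_subgroup_def by metis
  have "\<exists>l\<in>\<Lambda>. \<exists>f\<in>uminus ` F. x \<cdot> y = l \<cdot> f" if "x \<in> \<Lambda>" "y \<in> \<Lambda>" for x y
  proof -
    have "- y \<cdot> - x \<in> \<Lambda> <#>\<^bsub>heisenberg \<omega>\<^esub> \<Lambda>"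
      using approximate_subgroup_neg[OF assms] that
      unfolding set_mult_def heisenberg_mult_eq by blast
    then obtain f l where fl: "f \<in> F" "l \<in> \<Lambda>" "- y \<cdot> - x = f \<cdot> l"
      using F(2) unfolding set_mult_def heisenberg_mult_eq by blast
    have "x \<cdot> y = - (- y \<cdot> - x)" by (simp add: neg_mul)
    also have "\<dots> = - l \<cdot> - f" by (simp add: fl(3) neg_mul)
    finally show ?thesis using fl(1) approximate_subgroup_neg[OF assms fl(2)] by blast
  qed
  then show ?thesis using F(1) by (intro exI[of _ "uminus ` F"]) auto
qed

lemma discrete_approximate_subgroupI:
  assumes "heisenberg_metric \<omega> d" "approximate_subgroup (heisenberg \<omega>) \<Lambda>" "discrete_wrt d \<Lambda>"
  shows "discrete_approximate_subgroup \<omega> \<Lambda>"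
proof
  show "0 \<in> \<Lambda>" using assms(2) by (simp add: approximate_subgroup_def zero_prod_def)
qed (use assms in \<open>auto intro: approximate_subgroup_neg approximate_subgroup_cover
      dest: discrete_wrt_not_islimpt\<close>)

lemma subgroup_heisenberg:
  assumes "subspace H" "\<forall>h\<in>H. \<forall>k\<in>H. h \<cdot> k \<in> H"
  shows "subgroup H (heisenberg \<omega>)"
proof
  show "\<one>\<^bsub>heisenberg \<omega>\<^esub> \<in> H" using subspace_0[OF assms(1)] by (simp add: zero_prod_def)
qed (use assms in \<open>auto simp: heisenberg_mult_eq heisenberg_inv_eq subspace_neg\<close>)

lemma comm_group_heisenberg:
  assumes "subgroup H (heisenberg \<omega>)" "\<forall>h\<in>H. \<forall>k\<in>H. h \<cdot> k = k \<cdot> h"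
  shows "comm_group ((heisenberg \<omega>)\<lparr>carrier := H\<rparr>)"
proof (rule group.group_comm_groupI)
  show "group ((heisenberg \<omega>)\<lparr>carrier := H\<rparr>)"
    by (rule subgroup.subgroup_is_group[OF assms(1) heisenberg_group])
qed (use assms(2) in \<open>simp add: heisenberg_mult_eq\<close>)

end

lemma locally_finite_imp_discrete_wrt_dist:
  fixes A :: "'a::metric_space set"
  assumes "\<And>B. bounded B \<Longrightarrow> finite (A \<inter> B)"
  shows "discrete_wrt dist A"
  unfolding discrete_wrt_def
proof
  fix l assume "l \<in> A"
  obtain \<delta> where \<delta>: "\<delta> > 0" "\<forall>x\<in>A \<inter> cball l 1. x \<noteq> l \<longrightarrow> \<delta> \<le> dist l x"
    using finite_set_avoid[OF assms[OF bounded_cball[of l 1]], where a = l] by blast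
  have "A \<inter> cball l (min 1 (\<delta>/2)) = {l}"
    using \<delta> \<open>l \<in> A\<close> by force
  then show "\<exists>\<delta>>0. Metric_space.mcball UNIV dist l \<delta> \<inter> A = {l}"
    using \<delta>(1) by (intro exI[of _ "min 1 (\<delta>/2)"]) (auto simp: Int_commute)
qed

section \<open>The subgroup around which a discrete approximate subgroup is relatively dense\<close>

theorem theorem2p7:
  fixes n :: nat
    and \<omega> :: "real ^ 'd \<Rightarrow> real ^ 'd \<Rightarrow> real"
    and d :: "(real ^ 'd) \<times> real \<Rightarrow> (real ^ 'd) \<times> real \<Rightarrow> real"
    and \<Lambda> :: "((real ^ 'd) \<times> real) set"
  assumes "n \<ge> 1" and "CARD('d) = 2 * n"
    and "symplectic_form \<omega>"
    and "heisenberg_metric \<omega> d"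
    and "approximate_subgroup (heisenberg \<omega>) \<Lambda>"
    and "discrete_wrt d \<Lambda>"
    and "infinite \<Lambda>"
  shows "\<exists>H'. subgroup H' (heisenberg \<omega>) \<and>
              connectedin (Metric_space.mtopology UNIV d) H' \<and>
              H' \<noteq> {\<one>\<^bsub>heisenberg \<omega>\<^esub>} \<and>
              relatively_dense_around d \<Lambda> H' \<and>
              (\<not> comm_group ((heisenberg \<omega>)\<lparr>carrier := H'\<rparr>) \<longrightarrow> discrete_wrt dist (fst ` \<Lambda>))"
proof -
  interpret heisenberg_space \<omega>
    by (rule symplectic_form_imp_heisenberg_space) fact
  interpret discrete_approximate_subgroup \<omega> \<Lambda>
    by (rule discrete_approximate_subgroupI) fact+
  obtain H where H: "subspace H" "H \<noteq> {0}" "\<forall>h\<in>H. \<forall>k\<in>H. h \<cdot> k \<in> H" "coarsely_dense_around \<Lambda> H"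
    "(\<forall>h\<in>H. \<forall>k\<in>H. h \<cdot> k = k \<cdot> h) \<or> (\<forall>B. bounded B \<longrightarrow> finite (fst ` \<Lambda> \<inter> B))"
    using coarse_structure[OF \<open>infinite \<Lambda>\<close>] by blast
  have sub: "subgroup H (heisenberg \<omega>)" by (rule subgroup_heisenberg[OF H(1,3)])
  show ?thesis
  proof (intro exI[of _ H] conjI impI)
    show "connectedin (Metric_space.mtopology UNIV d) H"
      by (rule connectedin_subspace[OF \<open>heisenberg_metric \<omega> d\<close> H(1)])
    show "relatively_dense_around d \<Lambda> H"
      by (rule coarsely_dense_around_imp_relatively_dense_around[OF \<open>heisenberg_metric \<omega> d\<close> H(4)])
    assume "\<not> comm_group ((heisenberg \<omega>)\<lparr>carrier := H\<rparr>)"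
    then have "\<forall>B. bounded B \<longrightarrow> finite (fst ` \<Lambda> \<inter> B)"
      using comm_group_heisenberg[OF sub] H(5) by blast
    then show "discrete_wrt dist (fst ` \<Lambda>)"
      by (intro locally_finite_imp_discrete_wrt_dist) blast
  qed (use sub H(2) in \<open>auto simp: zero_prod_def\<close>)
qed

end
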